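(* For every $0<\alpha\le 1$ there exists an Ahlfors $\alpha$-regular (and therefore absolutely $\alpha$-decaying) measure $\mu$ on $\mathbb{R}$ such that for every function $\psi:\mathbb{N}\to(0,+\infty)$ for which $q\mapsto q^2\psi(q)$ is nonincreasing the following holds: if the series $$\sum_{q=1}^\infty q^{2\alpha-1}\psi(q)^\alpha$$ diverges, then $\mu$-almost every point is $\psi$-approximable; if the series converges, then $\mu$-almost no point is $\psi$-approximable.
   Context: All measures are Borel and locally finite. For $\delta>0$, a nonzero measure $\mu$ on $\mathbb{R}$ is Ahlfors $\delta$-regular if there exist constants $C_1,C_2>0$ such that $C_1r^\delta\le\mu(B(x,r))\le C_2r^\delta$ for all $x$ in the topological support of $\mu$ and all $0<r\le 1$. For $\alpha>0$, a measure $\mu$ on $\mathbb{R}$ is absolutely $\alpha$-decaying if there exists $C>0$ such that $\mu(B(x,\varepsilon r))\le C\varepsilon^\alpha\mu(B(x,r))$ for all $x\in\mathbb{R}$, all $0<r\le1$ and all $0<\varepsilon\le1$. An irrational $x$ is $\psi$-approximable if there exist infinitely many rationals $p/q$ (in lowest terms, $q\ge1$) with $|x-p/q|\le\psi(q)$. "$\mu$-almost no point" means that the set of such points is $\mu$-null. *)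

theory Defs
  imports "HOL-Analysis.Analysis"
begin

definition locally_finite_borel :: "real measure \<Rightarrow> bool" where
  "locally_finite_borel \<mu> \<longleftrightarrow>
     sets \<mu> = sets borel \<and> (\<forall>x. \<exists>U. open U \<and> x \<in> U \<and> emeasure \<mu> U < \<infinity>)"

definition msupport :: "real measure \<Rightarrow> real set" where
  "msupport \<mu> = {x. \<forall>U. open U \<longrightarrow> x \<in> U \<longrightarrow> emeasure \<mu> U > 0}"

text \<open>Balls are taken to be open. Passing to closed balls changes only the constants in the
  next two definitions.\<close>

definition ahlfors_regular :: "real \<Rightarrow> real measure \<Rightarrow> bool" where
  "ahlfors_regular \<delta> \<mu> \<longleftrightarrow>
     locally_finite_borel \<mu> \<and> emeasure \<mu> UNIV \<noteq> 0 \<and>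
     (\<exists>C1>0. \<exists>C2>0. \<forall>x\<in>msupport \<mu>. \<forall>r. 0 < r \<and> r \<le> 1 \<longrightarrow>
        ennreal (C1 * r powr \<delta>) \<le> emeasure \<mu> (ball x r) \<and>
        emeasure \<mu> (ball x r) \<le> ennreal (C2 * r powr \<delta>))"

definition absolutely_decaying :: "real \<Rightarrow> real measure \<Rightarrow> bool" where
  "absolutely_decaying \<alpha> \<mu> \<longleftrightarrow>
     locally_finite_borel \<mu> \<and>
     (\<exists>C>0. \<forall>x r \<epsilon>. 0 < r \<and> r \<le> 1 \<and> 0 < \<epsilon> \<and> \<epsilon> \<le> 1 \<longrightarrow>
        emeasure \<mu> (ball x (\<epsilon> * r)) \<le> ennreal (C * \<epsilon> powr \<alpha>) * emeasure \<mu> (ball x r))"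

text \<open>Pairs in lowest terms with positive denominator correspond bijectively to rationals. The
  value \<open>\<psi> 0\<close> plays no role.\<close>

definition psi_approximable :: "(nat \<Rightarrow> real) \<Rightarrow> real \<Rightarrow> bool" where
  "psi_approximable \<psi> x \<longleftrightarrow>
     x \<notin> \<rat> \<and>
     infinite {(p :: int, q :: nat). q \<ge> 1 \<and> coprime p (int q) \<and>
       \<bar>x - of_int p / of_nat q\<bar> \<le> \<psi> q}"

end

theory Submission imports Defs
begin

text \<open>
  Subdivide \<open>[0, 1]\<close> by continued fractions, interpolating between consecutive convergents by
  intervals such that each one is cut into two parts of comparable length. Distribute mass down this binary tree so
  that each surviving interval \<open>I\<close> carries mass \<open>c \<bar>I\<bar>\<^sup>\<alpha>\<close>, where the density \<open>c\<close> is kept in a fixed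
  range by a thermostat: if \<open>c \<ge> 1\<close>, both parts receive mass in proportion to their length to the power
  \<open>\<alpha>\<close>, which does not increase \<open>c\<close> because \<open>\<alpha> \<le> 1\<close>; if \<open>c < 1\<close>, only one part is kept, which
  increases \<open>c\<close>. The result is Ahlfors regular.

  Convergence holds for every absolutely decaying measure: balls of radius comparable to \<open>4\<^bsup>-n\<^esup>\<close> around the
  rationals with denominator in \<open>[2\<^sup>n, 2\<^bsup>n+1\<^esup>)\<close> are disjoint.

  In the divergence case, let \<open>p/q\<close> be a convergent. Among its possible next digits, the thermostat discards
  only ranges that are bounded, so \<open>p/q\<close> stays in the support. Hence, given the digits up
  to \<open>p/q\<close>, the next digit is large enough to make \<open>p/q\<close> a good approximation with probability
  at least a constant times \<open>min 1 (q\<^sup>2 \<psi>(q))\<^sup>\<alpha>\<close>. The \<open>\<alpha>/2\<close>-th moment of the denominators grows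
  at most geometrically, hence so do the denominators almost surely, and a conditional Borel--Cantelli
  argument applies.
\<close>

subsection \<open>Measures on binary trees of intervals\<close>

text \<open>Left and right are roles, not positions: the thermostat may drop the left child, never
  the right one. Which child lies lower depends on the node, because continued fractions alternate
  in orientation.\<close>

locale interval_tree =
  fixes valid :: "'s \<Rightarrow> bool" and left right :: "'s \<Rightarrow> 's" and lo hi :: "'s \<Rightarrow> real"
  assumes valid_left: "valid s \<Longrightarrow> valid (left s)"
    and valid_right: "valid s \<Longrightarrow> valid (right s)"
    and lo_less_hi: "valid s \<Longrightarrow> lo s < hi s"
    and children_adjacent: "valid s \<Longrightarrow>
      lo (left s) = lo s \<and> hi (left s) = lo (right s) \<and> hi (right s) = hi s \<or>
      lo (right s) = lo s \<and> hi (right s) = lo (left s) \<and> hi (left s) = hi s"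
    and left_ratio: "valid s \<Longrightarrow> hi s - lo s \<le> 3 * (hi (left s) - lo (left s))"
    and right_ratio: "valid s \<Longrightarrow> hi s - lo s \<le> 3 * (hi (right s) - lo (right s))"
begin

abbreviation len :: "'s \<Rightarrow> real" where "len s \<equiv> hi s - lo s"

lemma len_pos: "valid s \<Longrightarrow> 0 < len s"
  using lo_less_hi[of s] by simp

lemma len_children: "valid s \<Longrightarrow> len (left s) + len (right s) = len s"
  using children_adjacent[of s] by auto

lemma left_nested: "valid s \<Longrightarrow> lo s \<le> lo (left s) \<and> hi (left s) \<le> hi s"
  using children_adjacent[of s] len_pos[of "right s"] len_pos[of "left s"] valid_right[of s] valid_left[of s]
  by auto

lemma right_nested: "valid s \<Longrightarrow> lo s \<le> lo (right s) \<and> hi (right s) \<le> hi s"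
  using children_adjacent[of s] len_pos[of "right s"] len_pos[of "left s"] valid_right[of s] valid_left[of s]
  by auto

lemma len_left_le: "valid s \<Longrightarrow> len (left s) \<le> 2/3 * len s"
  using len_children[of s] right_ratio[of s] by argo

lemma len_right_le: "valid s \<Longrightarrow> len (right s) \<le> 2/3 * len s"
  using len_children[of s] left_ratio[of s] by argo

text \<open>Lengths shrink by 2/3 per level, so n bounds the number of levels down to the scale K.
  It is the induction parameter of the two scale arguments below.\<close>

lemma len_children_le_power:
  assumes "valid s" "len s \<le> (3/2) ^ Suc n * K"
  shows "len (left s) \<le> (3/2) ^ n * K" "len (right s) \<le> (3/2) ^ n * K"
proof -
  have *: "2/3 * len s \<le> (3/2) ^ n * K" using assms(2) by simp
  show "len (left s) \<le> (3/2) ^ n * K" "len (right s) \<le> (3/2) ^ n * K"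
    using order_trans[OF len_left_le[OF assms(1)] *] order_trans[OF len_right_le[OF assms(1)] *] .
qed

end

text \<open>An affine substitution: conditioned on the interval of the chosen child, the rescaled
  variable is again uniform on \<open>{0..<1}\<close>.\<close>

lemma measure_lborel_rescale:
  fixes g :: "real \<Rightarrow> real"
  assumes [measurable]: "g \<in> borel_measurable borel" "A \<in> sets borel" and c: "c > 0"
  shows "measure lborel {u \<in> {t..<t + c}. g ((u - t) / c) \<in> A} =
         c * measure lborel {u \<in> {0..<1}. g u \<in> A}"
proof -
  let ?S = "{u \<in> {t..<t + c}. g ((u - t) / c) \<in> A}"
  have S: "?S = {u \<in> space borel. t \<le> u \<and> u < t + c \<and> g ((u - t) / c) \<in> A}" by auto
  have [measurable]: "?S \<in> sets borel" unfolding S by measurable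
  have "emeasure lborel ?S = (\<integral>\<^sup>+x. indicator ?S x \<partial>lborel)" by simp
  also have "\<dots> = ennreal \<bar>c\<bar> * (\<integral>\<^sup>+x. indicator ?S (t + c * x) \<partial>lborel)"
    by (rule nn_integral_real_affine) (use c in auto)
  also have "(\<integral>\<^sup>+x. indicator ?S (t + c * x) \<partial>lborel) =
      (\<integral>\<^sup>+x. indicator {u \<in> {0..<1}. g u \<in> A} x \<partial>lborel)"
    using c by (intro nn_integral_cong) (auto simp: indicator_def zero_le_mult_iff)
  also have "\<dots> = emeasure lborel {u \<in> {0..<1}. g u \<in> A}"
  proof (rule nn_integral_indicator)
    have "{u \<in> {0..<1}. g u \<in> A} = {u \<in> space borel. 0 \<le> u \<and> u < 1 \<and> g u \<in> A}" by auto
    also have "\<dots> \<in> sets lborel" by measurable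
    finally show "{u \<in> {0..<1}. g u \<in> A} \<in> sets lborel" .
  qed
  finally show ?thesis using c by (simp add: measure_def enn2real_mult)
qed

section \<open>The random limit point of a weighted tree and its law\<close>

locale weighted_tree = interval_tree valid left right lo hi
  for valid :: "'s \<Rightarrow> bool" and left right :: "'s \<Rightarrow> 's" and lo hi :: "'s \<Rightarrow> real" +
  fixes P :: "'s \<Rightarrow> real"
  assumes P_nonneg: "valid s \<Longrightarrow> 0 \<le> P s" and P_le_1: "valid s \<Longrightarrow> P s \<le> 1"
begin

text \<open>The uniform variable \<open>u\<close> chooses a child and is then rescaled to be uniform again. A division by
  zero can only occur in a branch that no \<open>u\<close> in \<open>[0, 1)\<close> enters.\<close>

primrec approx :: "nat \<Rightarrow> 's \<Rightarrow> real \<Rightarrow> real" where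
  "approx 0 s u = lo s"
| "approx (Suc n) s u =
    (if u < 1 - P s then approx n (left s) (u / (1 - P s))
     else approx n (right s) ((u - (1 - P s)) / P s))"

lemma approx_bounds: "valid s \<Longrightarrow> lo s \<le> approx n s u \<and> approx n s u \<le> hi s"
proof (induction n arbitrary: s u)
  case 0
  then show ?case using lo_less_hi[of s] by simp
next
  case (Suc n)
  show ?case
    using Suc.IH[OF valid_left[OF Suc.prems]] Suc.IH[OF valid_right[OF Suc.prems]]
      left_nested[OF Suc.prems] right_nested[OF Suc.prems]
    by (auto intro: order_trans)
qed

text \<open>Both approximations follow the same first n choices, so they lie in one interval of
  depth n.\<close>

lemma approx_cauchy:
  "valid s \<Longrightarrow> n \<le> m \<Longrightarrow> \<bar>approx m s u - approx n s u\<bar> \<le> (2/3) ^ n * len s"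
proof (induction n arbitrary: s u m)
  case 0
  then show ?case using approx_bounds[of s m u] by simp
next
  case (Suc n)
  then obtain m' where m: "m = Suc m'" "n \<le> m'" by (cases m) auto
  have *: "\<bar>approx m' t v - approx n t v\<bar> \<le> (2/3) ^ Suc n * len s"
    if "valid t" "len t \<le> 2/3 * len s" for t v
  proof -
    have "(2/3) ^ n * len t \<le> (2/3) ^ n * (2/3 * len s)"
      by (intro mult_left_mono that(2)) auto
    then show ?thesis using Suc.IH[OF that(1) m(2), of v] by (simp only: power_Suc mult_ac)
  qed
  show ?case
    using *[OF valid_left len_left_le] *[OF valid_right len_right_le] Suc.prems(1) m(1) by simp
qed

lemma approx_measurable: "approx n s \<in> borel_measurable borel"
proof (induction n arbitrary: s)
  case 0
  have "approx 0 s = (\<lambda>u. lo s)" by (rule ext) simp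
  then show ?case by simp
next
  case (Suc n)
  note [measurable] = Suc.IH
  have "approx (Suc n) s = (\<lambda>u. if u < 1 - P s then approx n (left s) (u / (1 - P s))
     else approx n (right s) ((u - (1 - P s)) / P s))" by (rule ext) simp
  then show ?case by simp
qed

definition point :: "'s \<Rightarrow> real \<Rightarrow> real" where
  "point s u = lim (\<lambda>n. approx n s u)"

lemma approx_tendsto:
  assumes "valid s"
  shows "(\<lambda>n. approx n s u) \<longlonglongrightarrow> point s u"
proof -
  have "Cauchy (\<lambda>n. approx n s u)"
  proof (rule CauchyI')
    fix e :: real assume e: "e > 0"
    have "(\<lambda>n. (2/3) ^ n * len s) \<longlonglongrightarrow> 0 * len s"
      by (intro tendsto_intros LIMSEQ_realpow_zero) auto
    then have "eventually (\<lambda>n. (2/3) ^ n * len s < e) sequentially"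
      using e by (intro order_tendstoD(2)[where y="0 * len s"]) auto
    then obtain N where N: "\<And>n. n \<ge> N \<Longrightarrow> (2/3) ^ n * len s < e"
      by (auto simp: eventually_sequentially)
    show "\<exists>M. \<forall>m\<ge>M. \<forall>n>m. dist (approx m s u) (approx n s u) < e"
    proof (intro exI[of _ N] allI impI)
      fix m n assume "N \<le> m" "m < n"
      then show "dist (approx m s u) (approx n s u) < e"
        using approx_cauchy[OF assms, of m n u] N[of m] by (simp add: dist_real_def abs_minus_commute)
    qed
  qed
  then show ?thesis
    unfolding point_def using Cauchy_convergent convergent_LIMSEQ_iff by blast
qed

lemma point_unfold:
  assumes "valid s"
  shows "point s u = (if u < 1 - P s then point (left s) (u / (1 - P s))
     else point (right s) ((u - (1 - P s)) / P s))"
proof -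
  have "(\<lambda>n. approx (Suc n) s u) \<longlonglongrightarrow> point s u"
    using approx_tendsto[OF assms] by (rule LIMSEQ_Suc)
  moreover have "(\<lambda>n. approx (Suc n) s u) \<longlonglongrightarrow> (if u < 1 - P s then point (left s) (u / (1 - P s))
     else point (right s) ((u - (1 - P s)) / P s))"
    using approx_tendsto[OF valid_left[OF assms]] approx_tendsto[OF valid_right[OF assms]] by simp
  ultimately show ?thesis by (rule LIMSEQ_unique)
qed

lemma point_bounds: "valid s \<Longrightarrow> lo s \<le> point s u \<and> point s u \<le> hi s"
  using approx_bounds[of s _ u] approx_tendsto[of s u]
  by (meson LIMSEQ_le_const LIMSEQ_le_const2)

lemma point_measurable: "valid s \<Longrightarrow> point s \<in> borel_measurable borel"
  by (rule borel_measurable_LIMSEQ_real[where u="\<lambda>n. approx n s"])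
     (use approx_tendsto approx_measurable in auto)

definition law :: "'s \<Rightarrow> real measure" where
  "law s = distr (restrict_space lborel {0..<1}) borel (point s)"

lemma sets_law: "sets (law s) = sets borel"
  by (simp add: law_def)

lemma space_law: "space (law s) = UNIV"
  by (simp add: law_def)

lemma point_measurable_restrict:
  "valid s \<Longrightarrow> point s \<in> measurable (restrict_space lborel {0..<1}) borel"
  by (rule measurable_restrict_space1) (use point_measurable in simp)

lemma law_eq:
  assumes s: "valid s" and A: "A \<in> sets borel"
  shows "measure (law s) A = measure lborel {u \<in> {0..<1}. point s u \<in> A}"
proof -
  have "measure (law s) A =
      measure (restrict_space lborel {0..<1}) (point s -` A \<inter> space (restrict_space lborel {0..<1}))"
    unfolding law_def by (rule measure_distr[OF point_measurable_restrict[OF s] A])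
  also have "point s -` A \<inter> space (restrict_space lborel {0..<1}) = {u \<in> {0..<1}. point s u \<in> A}"
    by (auto simp: space_restrict_space)
  also have "measure (restrict_space lborel {0..<1}) \<dots> = measure lborel \<dots>"
    by (rule measure_restrict_space) auto
  finally show ?thesis .
qed

lemma finite_measure_law:
  assumes s: "valid s"
  shows "finite_measure (law s)"
proof -
  have "finite_measure (restrict_space lborel {0..<1::real})"
    by (rule finite_measureI) (simp add: emeasure_restrict_space space_restrict_space)
  then show ?thesis
    unfolding law_def by (rule finite_measure.finite_measure_distr[OF _ point_measurable_restrict[OF s]])
qed

lemma law_hull:
  assumes s: "valid s" and A: "A \<in> sets borel" "{lo s..hi s} \<subseteq> A"
  shows "measure (law s) A = 1"
proof -
  have "{u \<in> {0..<1}. point s u \<in> A} = {0..<1}" using point_bounds[OF s] A(2) by auto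
  then show ?thesis by (simp add: law_eq[OF s A(1)])
qed

text \<open>The first choice cuts [0, 1) into pieces of lengths \<open>1 - P s\<close> and
  \<open>P s\<close>, on each of which the construction restarts at a child.\<close>

lemma law_split:
  assumes s: "valid s" and A: "A \<in> sets borel"
  shows "measure (law s) A =
    (1 - P s) * measure (law (left s)) A + P s * measure (law (right s)) A"
proof -
  let ?p = "P s"
  let ?S1 = "{u \<in> {0..<0 + (1 - ?p)}. point (left s) ((u - 0) / (1 - ?p)) \<in> A}"
  let ?S2 = "{u \<in> {1 - ?p..<1 - ?p + ?p}. point (right s) ((u - (1 - ?p)) / ?p) \<in> A}"
  note p = P_nonneg[OF s] P_le_1[OF s]
  note [measurable] = point_measurable[OF valid_left[OF s]] point_measurable[OF valid_right[OF s]] A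
  have m1: "?S1 \<in> sets borel"
  proof -
    have "?S1 = {u \<in> space borel. 0 \<le> u \<and> u < 1 - ?p \<and> point (left s) (u / (1 - ?p)) \<in> A}" by auto
    also have "\<dots> \<in> sets borel" by measurable
    finally show ?thesis .
  qed
  have m2: "?S2 \<in> sets borel"
  proof -
    have "?S2 = {u \<in> space borel. 1 - ?p \<le> u \<and> u < 1 \<and> point (right s) ((u - (1 - ?p)) / ?p) \<in> A}" by auto
    also have "\<dots> \<in> sets borel" by measurable
    finally show ?thesis .
  qed
  have fin: "emeasure lborel B \<noteq> \<infinity>" if "B \<subseteq> {0..1}" for B :: "real set"
    using emeasure_mono[OF that, of lborel] by (auto simp: top_unique)
  have "?S1 \<subseteq> {0..1}" "?S2 \<subseteq> {0..1}" using p by auto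
  note fins = this[THEN fin]
  have "measure (law s) A = measure lborel {u \<in> {0..<1}. point s u \<in> A}"
    by (rule law_eq[OF s A])
  also have "{u \<in> {0..<1}. point s u \<in> A} = ?S1 \<union> ?S2"
    using p by (auto simp: point_unfold[OF s] split: if_splits)
  also have "measure lborel (?S1 \<union> ?S2) = measure lborel ?S1 + measure lborel ?S2"
    by (rule measure_Union[OF fins]) (use m1 m2 in auto)
  also have "measure lborel ?S1 = (1 - ?p) * measure (law (left s)) A"
  \<comment> \<open>An empty piece is treated apart, since the rescaling needs positive
    length.\<close>
  proof (cases "?p = 1")
    case False
    then show ?thesis
      using p by (subst measure_lborel_rescale) (simp_all add: law_eq[OF valid_left[OF s] A])
  qed simp
  also have "measure lborel ?S2 = ?p * measure (law (right s)) A"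
  proof (cases "?p = 0")
    case False
    then show ?thesis
      using p by (subst measure_lborel_rescale) (simp_all add: law_eq[OF valid_right[OF s] A])
  qed simp
  finally show ?thesis .
qed

end

subsection \<open>Ahlfors regularity by a thermostat\<close>

locale thermostat = interval_tree valid left right lo hi
  for valid :: "'s \<Rightarrow> bool" and left right :: "'s \<Rightarrow> 's" and lo hi :: "'s \<Rightarrow> real" +
  fixes \<alpha> :: real
  assumes \<alpha>_pos: "0 < \<alpha>" and \<alpha>_le_1: "\<alpha> \<le> 1"
begin

definition left_weight :: "'s \<Rightarrow> real" where
  "left_weight s = (len (left s) / len s) powr \<alpha>"

definition right_weight :: "'s \<Rightarrow> real" where
  "right_weight s = (len (right s) / len s) powr \<alpha>"

definition total_weight :: "'s \<Rightarrow> real" where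
  "total_weight s = left_weight s + right_weight s"

text \<open>For x in [0, 1] one has \<open>x \<le> x powr \<alpha> \<le> 1\<close>, as 0 < \<alpha>
  \<le> 1. The two length ratios add up to 1 and the right one is at least 1/3.\<close>

lemma weight_bounds:
  assumes "valid s"
  shows "1/3 \<le> right_weight s" "right_weight s \<le> 1" "0 \<le> left_weight s"
    "1 \<le> total_weight s" "total_weight s \<le> 2"
proof -
  note l = len_pos[OF assms] len_pos[OF valid_left[OF assms]] len_pos[OF valid_right[OF assms]]
  have x: "x \<le> x powr \<alpha>" "x powr \<alpha> \<le> 1" if "0 \<le> x" "x \<le> 1" for x :: real
    using powr_mono'[of \<alpha> 1 x] powr_mono'[of 0 \<alpha> x] that \<alpha>_pos \<alpha>_le_1
    by (cases "x = 0"; simp)+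
  have r: "0 \<le> len (right s) / len s" "len (right s) / len s \<le> 1" "1/3 \<le> len (right s) / len s"
    using l len_children[OF assms] right_ratio[OF assms] by (auto simp: field_simps)
  have f: "0 \<le> len (left s) / len s" "len (left s) / len s \<le> 1"
    using l len_children[OF assms] by (auto simp: field_simps)
  have "len (left s) / len s + len (right s) / len s = 1"
    using l len_children[OF assms] by (simp flip: add_divide_distrib)
  then show "1/3 \<le> right_weight s" "right_weight s \<le> 1" "0 \<le> left_weight s"
    "1 \<le> total_weight s" "total_weight s \<le> 2"
    using x[OF r(1,2)] x[OF f] r(3)
    unfolding total_weight_def right_weight_def left_weight_def
    by (simp_all only: powr_ge_zero)
qed

text \<open>A state \<open>(s, c)\<close> is an interval with its density. The density 1 of the left child for \<open>c < 1\<close> is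
  a dummy: that child has probability 0.\<close>

fun valid_state where
  "valid_state (s, c) \<longleftrightarrow> valid s \<and> 1/2 \<le> c \<and> c \<le> (3 :: real)"

fun left_state where
  "left_state (s, c) = (left s, if 1 \<le> c then c / total_weight s else 1)"

fun right_state where
  "right_state (s, c) = (right s, if 1 \<le> c then c / total_weight s else c / right_weight s)"

fun right_prob where
  "right_prob (s, c) = (if 1 \<le> (c :: real) then right_weight s / total_weight s else 1)"

text \<open>The range [1/2, 3] is stable: a density of at least 1 is divided by a number in [1, 2],
  a density below 1 by a number in [1/3, 1].\<close>

lemma next_density_bounds:
  assumes "valid s" "1/2 \<le> c" "c \<le> 3"
  shows "1 \<le> c \<Longrightarrow> 1/2 \<le> c / total_weight s \<and> c / total_weight s \<le> 3"
    and "c < 1 \<Longrightarrow> 1/2 \<le> c / right_weight s \<and> c / right_weight s \<le> 3"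
proof -
  note w = weight_bounds[OF assms(1)]
  show "1/2 \<le> c / total_weight s \<and> c / total_weight s \<le> 3" if "1 \<le> c"
    using w(4,5) assms that by (auto simp: pos_le_divide_eq pos_divide_le_eq)
  show "1/2 \<le> c / right_weight s \<and> c / right_weight s \<le> 3" if "c < 1"
    using w(1,2) assms that by (auto simp: pos_le_divide_eq pos_divide_le_eq)
qed

sublocale state: weighted_tree valid_state left_state right_state "lo \<circ> fst" "hi \<circ> fst" right_prob
proof
  fix s :: "'s \<times> real"
  obtain t c where s: "s = (t, c)" by (cases s)
  assume "valid_state s"
  then have v: "valid t" "1/2 \<le> c" "c \<le> 3" by (auto simp: s)
  note w = weight_bounds[OF v(1)]
  show "valid_state (left_state s)" "valid_state (right_state s)"
    using next_density_bounds[OF v] valid_left[OF v(1)] valid_right[OF v(1)]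
    by (simp_all add: s del: divide_le_eq_1_pos)
  show "(lo \<circ> fst) s < (hi \<circ> fst) s" using lo_less_hi[OF v(1)] by (simp add: s)
  show "(lo \<circ> fst) (left_state s) = (lo \<circ> fst) s \<and> (hi \<circ> fst) (left_state s) = (lo \<circ> fst) (right_state s) \<and>
        (hi \<circ> fst) (right_state s) = (hi \<circ> fst) s \<or>
      (lo \<circ> fst) (right_state s) = (lo \<circ> fst) s \<and> (hi \<circ> fst) (right_state s) = (lo \<circ> fst) (left_state s) \<and>
        (hi \<circ> fst) (left_state s) = (hi \<circ> fst) s"
    using children_adjacent[OF v(1)] by (simp add: s)
  show "(hi \<circ> fst) s - (lo \<circ> fst) s \<le> 3 * ((hi \<circ> fst) (left_state s) - (lo \<circ> fst) (left_state s))"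
    using left_ratio[OF v(1)] by (simp add: s)
  show "(hi \<circ> fst) s - (lo \<circ> fst) s \<le> 3 * ((hi \<circ> fst) (right_state s) - (lo \<circ> fst) (right_state s))"
    using right_ratio[OF v(1)] by (simp add: s)
  show "0 \<le> right_prob s" "right_prob s \<le> 1"
    using w(1,3,4) by (simp_all add: s total_weight_def)
qed

text \<open>The law rescaled to total mass \<open>c * len s powr \<alpha>\<close>. In this
  normalisation the branch probabilities cancel and masses simply add up over the surviving
  children.\<close>

definition mass :: "'s \<Rightarrow> real \<Rightarrow> real set \<Rightarrow> real" where
  "mass s c A = c * len s powr \<alpha> * measure (state.law (s, c)) A"

lemma law_finite: "valid s \<Longrightarrow> 1/2 \<le> c \<Longrightarrow> c \<le> 3 \<Longrightarrow> finite_measure (state.law (s, c))"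
  by (rule state.finite_measure_law) simp

lemma mass_nonneg: "0 \<le> c \<Longrightarrow> 0 \<le> mass s c A"
  by (simp add: mass_def)

lemma mass_mono:
  assumes "valid s" "1/2 \<le> c" "c \<le> 3" "A \<subseteq> B" "B \<in> sets borel"
  shows "mass s c A \<le> mass s c B"
  unfolding mass_def using assms
  by (intro mult_left_mono finite_measure.finite_measure_mono law_finite) (auto simp: state.sets_law)

lemma mass_hull:
  assumes "valid s" "1/2 \<le> c" "c \<le> 3" "A \<in> sets borel" "{lo s..hi s} \<subseteq> A"
  shows "mass s c A = c * len s powr \<alpha>"
  using state.law_hull[of "(s, c)" A] assms by (simp add: mass_def)

lemma mass_le:
  assumes "valid s" "1/2 \<le> c" "c \<le> 3"
  shows "mass s c A \<le> c * len s powr \<alpha>"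
proof (cases "A \<in> sets borel")
  case True
  then show ?thesis using mass_mono[OF assms, of A UNIV] mass_hull[OF assms, of UNIV] by simp
next
  case False
  then show ?thesis using assms by (simp add: mass_def measure_notin_sets state.sets_law)
qed

lemma mass_disjoint:
  assumes "valid s" "1/2 \<le> c" "c \<le> 3" "A \<in> sets borel" "{lo s..hi s} \<inter> A = {}"
  shows "mass s c A = 0"
proof -
  interpret finite_measure "state.law (s, c)" using assms by (intro law_finite)
  have "measure (state.law (s, c)) (UNIV - A) = measure (state.law (s, c)) UNIV - measure (state.law (s, c)) A"
    using finite_measure_compl[of A] assms(4) by (simp add: state.sets_law state.space_law)
  moreover have "measure (state.law (s, c)) (UNIV - A) = 1" "measure (state.law (s, c)) UNIV = 1"
    using state.law_hull[of "(s, c)" "UNIV - A"] state.law_hull[of "(s, c)" UNIV] assms by auto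
  ultimately show ?thesis by (simp add: mass_def)
qed

text \<open>Weights proportional to length to the power \<alpha> give both children the same density
  c'; if the left child is dropped, the whole mass moves right.\<close>

lemma mass_split:
  assumes s: "valid s" "1/2 \<le> c" "c \<le> 3"
  obtains c' where "1/2 \<le> c'" "c' \<le> 3"
    "\<And>A. A \<in> sets borel \<Longrightarrow> mass s c A = mass (left s) c' A + mass (right s) c' A"
  | c' where "1/2 \<le> c'" "c' \<le> 3"
    "\<And>A. A \<in> sets borel \<Longrightarrow> mass s c A = mass (right s) c' A"
proof (cases "1 \<le> c")
  case True
  note w = weight_bounds[OF s(1)]
  have eq: "mass s c A = mass (left s) (c / total_weight s) A + mass (right s) (c / total_weight s) A"
    if "A \<in> sets borel" for A
  proof -
    let ?m = "measure (state.law (left s, c / total_weight s)) A"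
    let ?m' = "measure (state.law (right s, c / total_weight s)) A"
    have p: "1 - right_prob (s, c) = left_weight s / total_weight s"
      using True w by (simp add: total_weight_def field_simps)
    have l: "len s powr \<alpha> * left_weight s = len (left s) powr \<alpha>"
      "len s powr \<alpha> * right_weight s = len (right s) powr \<alpha>"
      using len_pos[OF s(1)] len_pos[OF valid_left[OF s(1)]] len_pos[OF valid_right[OF s(1)]]
      unfolding left_weight_def right_weight_def by (simp_all flip: powr_mult)
    have "mass s c A = c * len s powr \<alpha> *
       ((1 - right_prob (s, c)) * ?m + right_prob (s, c) * ?m')"
      using state.law_split[of "(s, c)" A] s that True by (simp add: mass_def)
    also have "\<dots> = c / total_weight s * (len s powr \<alpha> * left_weight s) * ?m +
        c / total_weight s * (len s powr \<alpha> * right_weight s) * ?m'"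
      unfolding p using True by (simp add: field_simps)
    finally show ?thesis unfolding l by (simp add: mass_def)
  qed
  show ?thesis
    by (rule that(1)[OF _ _ eq]) (use next_density_bounds(1)[OF s True] in auto)
next
  case False
  note w = weight_bounds[OF s(1)]
  have eq: "mass s c A = mass (right s) (c / right_weight s) A" if "A \<in> sets borel" for A
  proof -
    have l: "len s powr \<alpha> * right_weight s = len (right s) powr \<alpha>"
      using len_pos[OF s(1)] len_pos[OF valid_right[OF s(1)]]
      unfolding right_weight_def by (simp flip: powr_mult)
    have "mass s c A = c / right_weight s * (len s powr \<alpha> * right_weight s) *
        measure (state.law (right s, c / right_weight s)) A"
      using state.law_split[of "(s, c)" A] s that False w by (simp add: mass_def)
    then show ?thesis unfolding l by (simp add: mass_def)
  qed
  show ?thesis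
    by (rule that(2)[OF _ _ eq]) (use next_density_bounds(2)[OF s] False in auto)
qed

text \<open>The right-hand side is additive over the two children, so it can be propagated up the tree from the intervals
  of length about \<open>\<delta>\<close>, where \<open>len s powr \<alpha>\<close> is comparable to \<open>\<delta> powr (\<alpha> - 1) * len s\<close>.\<close>

lemma mass_interval_le_overlap:
  fixes y \<delta> :: real
  assumes \<delta>: "\<delta> > 0"
  defines "trunc \<equiv> \<lambda>x. max (y - \<delta>) (min (y + 2 * \<delta>) x)"
  assumes "valid s" "1/2 \<le> c" "c \<le> 3" "\<delta> \<le> 3 * len s" "len s \<le> (3/2) ^ n * \<delta>"
  shows "mass s c {y..y + \<delta>} \<le> 9 * \<delta> powr (\<alpha> - 1) * (trunc (hi s) - trunc (lo s))"
  using assms(3-)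
proof (induction n arbitrary: s c)
  have small: "mass s c {y..y + \<delta>} \<le> 9 * \<delta> powr (\<alpha> - 1) * (trunc (hi s) - trunc (lo s))"
    if s: "valid s" "1/2 \<le> c" "c \<le> 3" and l: "\<delta> \<le> 3 * len s" "len s \<le> \<delta>" for s c
  proof (cases "{lo s..hi s} \<inter> {y..y + \<delta>} = {}")
    case True
    have "trunc (lo s) \<le> trunc (hi s)"
      unfolding trunc_def using lo_less_hi[OF s(1)] by (intro max.mono min.mono) auto
    then show ?thesis using mass_disjoint[OF s _ True] by simp
  next
    case False
    then have "lo s \<le> y + \<delta>" "y \<le> hi s" by auto
    \<comment> \<open>An interval no longer than \<delta> that meets [y, y + \<delta>] lies in
      [y - \<delta>, y + 2\<delta>], where the truncation is the identity.\<close>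
    then have ov: "trunc (hi s) - trunc (lo s) = len s"
      using l lo_less_hi[OF s(1)] unfolding trunc_def by (simp add: min_absorb2 max_absorb2)
    have "len s powr (\<alpha> - 1) \<le> (\<delta> / 3) powr (\<alpha> - 1)"
      using l \<delta> \<alpha>_le_1 by (intro powr_mono2') auto
    also have "\<dots> = \<delta> powr (\<alpha> - 1) * 3 powr (1 - \<alpha>)"
      using \<delta> by (simp add: powr_divide powr_diff field_simps)
    also have "\<dots> \<le> \<delta> powr (\<alpha> - 1) * 3 powr 1"
      using \<alpha>_pos by (intro mult_left_mono powr_mono) auto
    finally have a: "len s powr (\<alpha> - 1) \<le> 3 * \<delta> powr (\<alpha> - 1)" by simp
    have "mass s c {y..y + \<delta>} \<le> c * len s powr \<alpha>" by (rule mass_le[OF s])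
    also have "len s powr \<alpha> = len s powr (\<alpha> - 1) * len s"
      using len_pos[OF s(1)] by (simp add: powr_diff)
    \<comment> \<open>The 9 is 3 * 3: the density is at most 3, and
      \<open>\<delta> / 3 \<le> len s\<close> costs
      \<open>3 powr (1 - \<alpha>) \<le> 3\<close>.\<close>
    also have "c * (len s powr (\<alpha> - 1) * len s) \<le> 3 * ((3 * \<delta> powr (\<alpha> - 1)) * len s)"
      using a s len_pos[OF s(1)] by (intro mult_mono mult_right_mono) auto
    finally show ?thesis unfolding ov by simp
  qed
  {
    case 0
    then show ?case using small[of s c] by simp
  next
    case (Suc n)
    note s = Suc.prems(1-3)
    show ?case
    proof (cases "len s \<le> \<delta>")
      case True
      then show ?thesis using small Suc.prems by blast
    next
      case False
      have ov: "trunc (hi (left s)) - trunc (lo (left s)) + (trunc (hi (right s)) - trunc (lo (right s))) =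
          trunc (hi s) - trunc (lo s)"
        using children_adjacent[OF s(1)] by (elim disjE conjE) simp_all
      have nn: "0 \<le> trunc (hi (left s)) - trunc (lo (left s))"
        unfolding trunc_def using lo_less_hi[OF valid_left[OF s(1)]]
        by (simp only: diff_ge_0_iff_ge)
      have L: "mass (left s) c' {y..y + \<delta>} \<le> 9 * \<delta> powr (\<alpha> - 1) * (trunc (hi (left s)) - trunc (lo (left s)))"
        if "1/2 \<le> c'" "c' \<le> 3" for c'
        using False left_ratio[OF s(1)] len_children_le_power[OF s(1) Suc.prems(5)]
        by (intro Suc.IH valid_left s that) auto
      have R: "mass (right s) c' {y..y + \<delta>} \<le> 9 * \<delta> powr (\<alpha> - 1) * (trunc (hi (right s)) - trunc (lo (right s)))"
        if "1/2 \<le> c'" "c' \<le> 3" for c'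
        using False right_ratio[OF s(1)] len_children_le_power[OF s(1) Suc.prems(5)]
        by (intro Suc.IH valid_right s that) auto
      from s show ?thesis
      proof (cases rule: mass_split)
        case (1 c')
        then show ?thesis using L[OF 1(1,2)] R[OF 1(1,2)]
          by (simp add: ov[symmetric] distrib_left)
      next
        case (2 c')
        have "mass s c {y..y + \<delta>} \<le> 9 * \<delta> powr (\<alpha> - 1) * (trunc (hi (right s)) - trunc (lo (right s)))"
          using 2 R[OF 2(1,2)] by simp
        also have "\<dots> \<le> 9 * \<delta> powr (\<alpha> - 1) * (trunc (hi s) - trunc (lo s))"
          using ov nn by (intro mult_left_mono) auto
        finally show ?thesis .
      qed
    qed
  }
qed

text \<open>The truncation takes values in an interval of length 3\<delta>, so the overlap is at
  most 3\<delta> and 27 = 9 * 3.\<close>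

lemma mass_interval_le:
  assumes "\<delta> > 0" "valid s" "1/2 \<le> c" "c \<le> 3" "\<delta> \<le> 3 * len s"
  shows "mass s c {y..y + \<delta>} \<le> 27 * \<delta> powr \<alpha>"
proof -
  obtain n where n: "len s / \<delta> < (3/2) ^ n" using real_arch_pow[of "3/2" "len s / \<delta>"] by auto
  define f where "f \<equiv> \<lambda>x. max (y - \<delta>) (min (y + 2 * \<delta>) x)"
  have "mass s c {y..y + \<delta>} \<le> 9 * \<delta> powr (\<alpha> - 1) * (f (hi s) - f (lo s))"
    unfolding f_def
    by (rule mass_interval_le_overlap[OF assms, where n=n]) (use n assms in \<open>auto simp: field_simps\<close>)
  also have "\<dots> \<le> 9 * \<delta> powr (\<alpha> - 1) * (3 * \<delta>)"
    using assms(1) unfolding f_def by (intro mult_left_mono) (simp_all add: max_def min_def)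
  also have "\<dots> = 27 * \<delta> powr \<alpha>" using assms(1) by (simp add: powr_diff)
  finally show ?thesis .
qed

text \<open>Descend through children with positive mass in the half ball until the length is at most
  r/2. The node reached meets the half ball, hence lies in the full ball; its length is at least
  r/6, since a child keeps a third, and its density at least 1/2.\<close>

lemma mass_ball_ge:
  assumes r: "r > 0"
    and "valid s" "1/2 \<le> c" "c \<le> 3" "r \<le> 6 * len s" "mass s c (ball y (r/2)) > 0"
    and "len s \<le> (3/2) ^ n * (r/2)"
  shows "mass s c (ball y r) \<ge> 1/2 * (r/6) powr \<alpha>"
  using assms(2-)
proof (induction n arbitrary: s c)
  have small: "mass s c (ball y r) \<ge> 1/2 * (r/6) powr \<alpha>"
    if s: "valid s" "1/2 \<le> c" "c \<le> 3" and l: "r \<le> 6 * len s" "len s \<le> r/2"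
      and m: "mass s c (ball y (r/2)) > 0" for s c
  proof -
    have "{lo s..hi s} \<inter> ball y (r/2) \<noteq> {}"
      using m mass_disjoint[OF s, of "ball y (r/2)"] by auto
    then obtain z where "lo s \<le> z" "z \<le> hi s" "\<bar>y - z\<bar> < r/2" by (auto simp: dist_real_def)
    then have "\<bar>y - x\<bar> < r" if "lo s \<le> x" "x \<le> hi s" for x
      using l that by argo
    then have "{lo s..hi s} \<subseteq> ball y r"
      by (auto simp: dist_real_def)
    then have "mass s c (ball y r) = c * len s powr \<alpha>"
      by (intro mass_hull s) auto
    moreover have "1/2 * (r/6) powr \<alpha> \<le> c * len s powr \<alpha>"
      using s l r \<alpha>_pos by (intro mult_mono powr_mono2) auto
    ultimately show ?thesis by simp
  qed
  {
    case 0
    then show ?case using small[of s c] by simp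
  next
    case (Suc n)
    note s = Suc.prems(1-3)
    show ?case
    proof (cases "len s \<le> r/2")
      case True
      then show ?thesis using small Suc.prems by blast
    next
      case False
      have L: "mass (left s) c' (ball y r) \<ge> 1/2 * (r/6) powr \<alpha>"
        if "1/2 \<le> c'" "c' \<le> 3" "mass (left s) c' (ball y (r/2)) > 0" for c'
        using False left_ratio[OF s(1)] len_children_le_power[OF s(1) Suc.prems(6)]
        by (intro Suc.IH valid_left s that) auto
      have R: "mass (right s) c' (ball y r) \<ge> 1/2 * (r/6) powr \<alpha>"
        if "1/2 \<le> c'" "c' \<le> 3" "mass (right s) c' (ball y (r/2)) > 0" for c'
        using False right_ratio[OF s(1)] len_children_le_power[OF s(1) Suc.prems(6)]
        by (intro Suc.IH valid_right s that) auto
      from s show ?thesis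
      proof (cases rule: mass_split)
        case (1 c')
        then have c': "0 \<le> c'" by simp
        have "mass (left s) c' (ball y (r/2)) > 0 \<or> mass (right s) c' (ball y (r/2)) > 0"
          using 1(3)[of "ball y (r/2)"] Suc.prems(5) by auto
        then show ?thesis
          using L[OF 1(1,2)] R[OF 1(1,2)] 1(3)[of "ball y r"]
            mass_nonneg[OF c', of "left s" "ball y r"] mass_nonneg[OF c', of "right s" "ball y r"]
          by auto
      next
        case (2 c')
        then show ?thesis using R[OF 2(1,2)] 2(3)[of "ball y r"] 2(3)[of "ball y (r/2)"] Suc.prems(5)
          by auto
      qed
    qed
  }
qed

theorem ahlfors_regular_law:
  assumes s: "valid s" "1/2 \<le> c" "c \<le> 3" and len: "len s \<ge> 1"
  shows "ahlfors_regular \<alpha> (state.law (s, c))"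
proof -
  let ?\<mu> = "state.law (s, c)"
  interpret finite_measure ?\<mu> using s by (intro law_finite)
  have m1: "measure ?\<mu> UNIV = 1" using state.law_hull[of "(s, c)" UNIV] s by auto
  define M where "M = c * len s powr \<alpha>"
  have M: "M > 0" using s len by (simp add: M_def)
  have mm: "measure ?\<mu> A = mass s c A / M" for A
    using M unfolding mass_def M_def[symmetric] by simp
  have lf: "locally_finite_borel ?\<mu>"
    unfolding locally_finite_borel_def
    by (auto simp: state.sets_law less_top[symmetric] intro!: exI[of _ UNIV])
  have "ennreal (1/2 * (1/6) powr \<alpha> / M * r powr \<alpha>) \<le> emeasure ?\<mu> (ball x r) \<and>
        emeasure ?\<mu> (ball x r) \<le> ennreal (27 * 2 powr \<alpha> / M * r powr \<alpha>)"
    if x: "x \<in> msupport ?\<mu>" and r: "0 < r" "r \<le> 1" for x r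
  proof
    obtain n where n: "len s / (r/2) < (3/2) ^ n" using real_arch_pow[of "3/2" "len s / (r/2)"] by auto
    \<comment> \<open>The support is used at radius r/2, as \<open>mass_ball_ge\<close>
      demands.\<close>
    have "emeasure ?\<mu> (ball x (r/2)) > 0" using x r by (auto simp: msupport_def)
    then have "mass s c (ball x (r/2)) > 0"
      using M by (simp add: emeasure_eq_measure mm zero_less_divide_iff)
    then have "mass s c (ball x r) \<ge> 1/2 * (r/6) powr \<alpha>"
      by (intro mass_ball_ge[where n=n] r s) (use n r len in \<open>auto simp: field_simps\<close>)
    then have "1/2 * (1/6) powr \<alpha> / M * r powr \<alpha> \<le> mass s c (ball x r) / M"
      using M r by (simp add: powr_divide field_simps)
    then show "ennreal (1/2 * (1/6) powr \<alpha> / M * r powr \<alpha>) \<le> emeasure ?\<mu> (ball x r)"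
      by (simp add: emeasure_eq_measure mm ennreal_leI)
    \<comment> \<open>The ball has diameter 2r, so the upper bound applies with \<delta> = 2r; it is
      admissible because r \<le> 1 \<le> \<open>len s\<close>.\<close>
    have "mass s c (ball x r) \<le> mass s c {x - r..x - r + 2 * r}"
      by (rule mass_mono[OF s]) (auto simp: dist_real_def)
    also have "\<dots> \<le> 27 * (2 * r) powr \<alpha>"
      by (rule mass_interval_le) (use s r len in auto)
    finally have "mass s c (ball x r) / M \<le> 27 * 2 powr \<alpha> / M * r powr \<alpha>"
      using M r by (simp add: powr_mult field_simps)
    then show "emeasure ?\<mu> (ball x r) \<le> ennreal (27 * 2 powr \<alpha> / M * r powr \<alpha>)"
      by (simp add: emeasure_eq_measure mm ennreal_leI)
  qed
  moreover have "emeasure ?\<mu> UNIV \<noteq> 0" using m1 by (simp add: emeasure_eq_measure)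
  ultimately show ?thesis
    unfolding ahlfors_regular_def using lf M
    by (intro conjI exI[of _ "1/2 * (1/6) powr \<alpha> / M"] exI[of _ "27 * 2 powr \<alpha> / M"]) auto
qed

end

subsection \<open>The continued fraction tree\<close>

abbreviation quot :: "int \<Rightarrow> int \<Rightarrow> real" where
  "quot a b \<equiv> real_of_int a / real_of_int b"

text \<open>For consecutive convergents \<open>p'/q'\<close> and \<open>p/q\<close>, the points whose next digit is at least \<open>k\<close> form the
  interval between \<open>(k p + p')/(k q + q')\<close> and \<open>p/q\<close>: this is \<open>Tail a b p q\<close> with
  \<open>a = k p + p'\<close>, \<open>b = k q + q'\<close>. Those with next digit in \<open>[k, k + n)\<close> form the interval between
  \<open>a/b\<close> and \<open>(a + n p)/(b + n q)\<close>: this is \<open>Block a b p q n\<close>. A block of a single digit is again a tail, around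
  the next convergent \<open>a/b\<close>.\<close>

datatype node = Tail int int int int | Block int int int int int

fun endpoint :: "node \<Rightarrow> real" where
  "endpoint (Tail a b p q) = quot p q"
| "endpoint (Block a b p q n) = quot (a + n * p) (b + n * q)"

fun startpoint :: "node \<Rightarrow> real" where
  "startpoint (Tail a b p q) = quot a b"
| "startpoint (Block a b p q n) = quot a b"

definition node_lo :: "node \<Rightarrow> real" where
  "node_lo v = min (startpoint v) (endpoint v)"

definition node_hi :: "node \<Rightarrow> real" where
  "node_hi v = max (startpoint v) (endpoint v)"

definition block :: "int \<Rightarrow> int \<Rightarrow> int \<Rightarrow> int \<Rightarrow> int \<Rightarrow> node" where
  "block a b p q n = (if n = 1 then Tail (a + p) (b + q) a b else Block a b p q n)"

text \<open>Advancing a tail by \<open>b div q\<close> digits adds between b/2 and b to the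
  denominator, which balances the parts. The part next to p/q is the right child; as that child is
  never dropped, mass survives arbitrarily close to p/q.\<close>

fun node_left :: "node \<Rightarrow> node" where
  "node_left (Tail a b p q) = block a b p q (b div q)"
| "node_left (Block a b p q n) = block a b p q (n div 2)"

fun node_right :: "node \<Rightarrow> node" where
  "node_right (Tail a b p q) = Tail (a + b div q * p) (b + b div q * q) p q"
| "node_right (Block a b p q n) =
    block (a + n div 2 * p) (b + n div 2 * q) p q (n - n div 2)"

text \<open>The determinant condition makes a/b and p/q Farey neighbours. In a block,
  \<open>n * q \<le> b\<close> keeps the denominators within a factor 2, so that lengths are
  comparable to numbers of digits.\<close>

fun valid_node :: "node \<Rightarrow> bool" where
  "valid_node (Tail a b p q) \<longleftrightarrow> 1 \<le> q \<and> q \<le> b \<and> \<bar>a * q - b * p\<bar> = 1"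
| "valid_node (Block a b p q n) \<longleftrightarrow>
    1 \<le> q \<and> q \<le> b \<and> \<bar>a * q - b * p\<bar> = 1 \<and> 2 \<le> n \<and> n * q \<le> b"

lemma valid_block:
  assumes "1 \<le> q" "\<bar>a * q - b * p\<bar> = 1" "1 \<le> n" "n * q \<le> b"
  shows "valid_node (block a b p q n)"
proof -
  have "1 * q \<le> n * q" using assms by (intro mult_right_mono) auto
  then have "q \<le> b" using assms by linarith
  moreover have "\<bar>(a + p) * b - (b + q) * a\<bar> = \<bar>a * q - b * p\<bar>"
    by (simp add: algebra_simps abs_minus_commute)
  ultimately show ?thesis using assms by (auto simp: block_def)
qed

lemma block_lo_hi:
  "node_lo (block a b p q n) = min (quot a b) (quot (a + n * p) (b + n * q))"
  "node_hi (block a b p q n) = max (quot a b) (quot (a + n * p) (b + n * q))"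
  by (auto simp: block_def node_lo_def node_hi_def min.commute max.commute)

text \<open>Fractions differ by their determinant over the product of their denominators, and the
  determinant here is \<open>(k - j) * (b * p - a * q)\<close>. Its sign fixes the
  orientation.\<close>

lemma mediant_order:
  fixes a b p q j k :: int
  assumes "b > 0" "q > 0" "0 \<le> j" "j < k"
  shows "a * q - b * p = -1 \<Longrightarrow> quot (a + k * p) (b + k * q) - quot (a + j * p) (b + j * q) =
      (k - j) / ((b + j * q) * (b + k * q))"
    and "a * q - b * p = 1 \<Longrightarrow> quot (a + j * p) (b + j * q) - quot (a + k * p) (b + k * q) =
      (k - j) / ((b + j * q) * (b + k * q))"
proof -
  have jk: "b + j * q > 0" "b + k * q > 0" using assms by (auto intro!: add_pos_nonneg)
  then have pos: "real_of_int (b + j * q) > 0" "real_of_int (b + k * q) > 0" by linarith+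
  have "quot (a + k * p) (b + k * q) - quot (a + j * p) (b + j * q) =
     of_int ((a + k * p) * (b + j * q) - (a + j * p) * (b + k * q)) / (of_int (b + j * q) * of_int (b + k * q))"
    using pos by (subst diff_frac_eq) (simp_all only: of_int_diff of_int_mult mult.commute less_irrefl not_False_eq_True)
  also have "(a + k * p) * (b + j * q) - (a + j * p) * (b + k * q) = (k - j) * (b * p - a * q)"
    by (simp add: algebra_simps)
  finally have *: "quot (a + k * p) (b + k * q) - quot (a + j * p) (b + j * q) =
      of_int ((k - j) * (b * p - a * q)) / (of_int (b + j * q) * of_int (b + k * q))" .
  show "quot (a + k * p) (b + k * q) - quot (a + j * p) (b + j * q) = (k - j) / ((b + j * q) * (b + k * q))" if "a * q - b * p = -1"
  proof -
    have "b * p - a * q = 1" using that by simp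
    then show ?thesis using * by simp
  qed
  show "quot (a + j * p) (b + j * q) - quot (a + k * p) (b + k * q) = (k - j) / ((b + j * q) * (b + k * q))" if "a * q - b * p = 1"
  proof -
    have "b * p - a * q = -1" using that by simp
    then have "quot (a + k * p) (b + k * q) - quot (a + j * p) (b + j * q) = - ((k - j) / ((b + j * q) * (b + k * q)))"
      unfolding * by (simp flip: divide_minus_left)
    then show ?thesis by linarith
  qed
qed

lemma tail_order:
  fixes a b p q k :: int
  assumes "b > 0" "q > 0" "0 \<le> k"
  shows "a * q - b * p = -1 \<Longrightarrow> quot p q - quot (a + k * p) (b + k * q) = 1 / (q * (b + k * q))"
    and "a * q - b * p = 1 \<Longrightarrow> quot (a + k * p) (b + k * q) - quot p q = 1 / (q * (b + k * q))"
proof -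
  have "b + k * q > 0" using assms by (auto intro!: add_pos_nonneg)
  then have pos: "real_of_int (b + k * q) > 0" "real_of_int q > 0" using assms by linarith+
  have "quot p q - quot (a + k * p) (b + k * q) =
     of_int (p * (b + k * q) - (a + k * p) * q) / (of_int q * of_int (b + k * q))"
    using pos by (subst diff_frac_eq) (simp_all only: of_int_diff of_int_mult mult.commute less_irrefl not_False_eq_True)
  also have "p * (b + k * q) - (a + k * p) * q = b * p - a * q"
    by (simp add: algebra_simps)
  finally have *: "quot p q - quot (a + k * p) (b + k * q) =
      of_int (b * p - a * q) / (of_int q * of_int (b + k * q))" .
  show "quot p q - quot (a + k * p) (b + k * q) = 1 / (q * (b + k * q))" if "a * q - b * p = -1"
  proof -
    have "b * p - a * q = 1" using that by simp
    then show ?thesis using * by simp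
  qed
  show "quot (a + k * p) (b + k * q) - quot p q = 1 / (q * (b + k * q))" if "a * q - b * p = 1"
  proof -
    have "b * p - a * q = -1" using that by simp
    then have "quot p q - quot (a + k * p) (b + k * q) = - (1 / (q * (b + k * q)))"
      unfolding * by (simp flip: divide_minus_left)
    then show ?thesis by linarith
  qed
qed

lemma max_minus_min: "max x y - min x y = \<bar>x - y\<bar>" for x y :: real
  by (simp add: max_def min_def)

lemma abs_diff_eqI: "0 < z \<Longrightarrow> y - x = z \<or> x - y = z \<Longrightarrow> \<bar>x - y\<bar> = z" for x y z :: real
  by auto

lemma tail_len:
  assumes "valid_node (Tail a b p q)"
  shows "node_hi (Tail a b p q) - node_lo (Tail a b p q) = 1 / (q * b)"
proof -
  from assms have *: "b > 0" "q > 0" "a * q - b * p = -1 \<or> a * q - b * p = 1" by auto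
  have pos: "1 / real_of_int (q * b) > 0" using * by simp
  have "quot p q - quot a b = 1 / (q * b) \<or> quot a b - quot p q = 1 / (q * b)"
    using tail_order[OF *(1,2), of 0 a p] *(3) by auto
  then have "\<bar>quot a b - quot p q\<bar> = 1 / (q * b)" by (rule abs_diff_eqI[OF pos])
  then show ?thesis unfolding node_lo_def node_hi_def max_minus_min by simp
qed

text \<open>Dropping b from b + n q turns the exact length n / (b (b + n q)) into the length of the
  tail around p/q that contains the block.\<close>

lemma block_len_le:
  assumes "1 \<le> q" "\<bar>a * q - b * p\<bar> = 1" "1 \<le> n" "n * q \<le> b"
  shows "node_hi (block a b p q n) - node_lo (block a b p q n) \<le> 1 / (q * b)"
proof -
  have "1 * q \<le> n * q" using assms by (intro mult_right_mono) auto
  then have *: "b > 0" "q > 0" "a * q - b * p = -1 \<or> a * q - b * p = 1" "0 < n" using assms by linarith+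
  define D where "D = real_of_int n / (real_of_int b * of_int (b + n * q))"
  have D: "D \<le> 1 / (q * b)"
  proof -
    have pos: "0 < real_of_int b + n * q" using * by (simp add: add_pos_pos)
    have "D \<le> n / (real_of_int b * (n * q))"
      unfolding D_def using * pos by (intro divide_left_mono mult_left_mono mult_pos_pos) auto
    also have "\<dots> = 1 / (q * b)" using * by simp
    finally show ?thesis .
  qed
  have pos: "0 < D"
    unfolding D_def using * by (auto intro!: divide_pos_pos mult_pos_pos add_pos_pos)
  have "quot (a + n * p) (b + n * q) - quot a b = D \<or> quot a b - quot (a + n * p) (b + n * q) = D"
    using mediant_order[OF *(1,2) order_refl *(4), of a p] *(3) by (auto simp: D_def)
  then have "\<bar>quot a b - quot (a + n * p) (b + n * q)\<bar> = D" by (rule abs_diff_eqI[OF pos])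
  then show ?thesis using D unfolding block_lo_hi max_minus_min by simp
qed

text \<open>The order and ratio axioms of \<open>interval_tree\<close> all follow, in either
  orientation, from a cut into two parts that differ by at most a factor 2.\<close>

lemma split_at_point:
  fixes x y z :: real
  assumes "x < y \<and> y < z \<or> z < y \<and> y < x" "\<bar>y - x\<bar> \<le> 2 * \<bar>z - y\<bar>" "\<bar>z - y\<bar> \<le> 2 * \<bar>y - x\<bar>"
  shows "min x z < max x z"
    "min x y = min x z \<and> max x y = min y z \<and> max y z = max x z \<or>
     min y z = min x z \<and> max y z = min x y \<and> max x y = max x z"
    "max x z - min x z \<le> 3 * (max x y - min x y)" "max x z - min x z \<le> 3 * (max y z - min y z)"
  using assms by (auto simp: min_def max_def)

lemma tail_split:
  assumes "valid_node (Tail a b p q)"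
  defines "x \<equiv> quot a b" and "y \<equiv> quot (a + b div q * p) (b + b div q * q)" and "z \<equiv> quot p q"
  shows "x < y \<and> y < z \<or> z < y \<and> y < x" "\<bar>y - x\<bar> \<le> 2 * \<bar>z - y\<bar>" "\<bar>z - y\<bar> \<le> 2 * \<bar>y - x\<bar>"
proof -
  define n where "n = b div q"
  from assms have *: "b > 0" "q > 0" "a * q - b * p = -1 \<or> a * q - b * p = 1" "q \<le> b" by auto
  have n: "n \<ge> 1" using * by (simp add: n_def pos_imp_zdiv_pos_iff int_one_le_iff_zero_less)
  have bq: "b = n * q + b mod q" by (simp add: n_def)
  moreover have "b mod q < q" "0 \<le> b mod q" "1 * q \<le> n * q" using * n by (auto simp del: mult_1)
  ultimately have nq: "n * q \<le> b" "b \<le> 2 * (n * q)" by linarith+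
  \<comment> \<open>The lengths u and w of the two parts have ratio w / u = b / (n q), which lies in
    [1, 2].\<close>
  define u where "u = real_of_int n / (real_of_int b * (b + n * q))"
  define w where "w = 1 / (real_of_int q * (b + n * q))"
  have pos: "0 < real_of_int b + n * q" using * n by (auto intro!: add_pos_pos)
  have "u > 0" "w > 0" unfolding u_def w_def using pos * n by auto
  moreover have "u \<le> w" "w \<le> 2 * u"
  proof -
    have "real_of_int (n * q) \<le> real_of_int b" "real_of_int b \<le> real_of_int (2 * (n * q))"
      using nq by (simp_all only: of_int_le_iff)
    then show "u \<le> w" "w \<le> 2 * u"
      unfolding u_def w_def using pos * n by (simp_all add: divide_simps)
  qed
  moreover have "y - x = u \<and> z - y = w \<or> x - y = u \<and> y - z = w"
    using mediant_order[OF *(1,2) order_refl, of n a p] tail_order[OF *(1,2), of n a p] n *(3)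
    unfolding x_def y_def z_def u_def w_def n_def[symmetric] by auto
  ultimately show "x < y \<and> y < z \<or> z < y \<and> y < x" "\<bar>y - x\<bar> \<le> 2 * \<bar>z - y\<bar>" "\<bar>z - y\<bar> \<le> 2 * \<bar>y - x\<bar>"
    by auto
qed

lemma block_split:
  assumes "valid_node (Block a b p q n)"
  defines "x \<equiv> quot a b" and "y \<equiv> quot (a + n div 2 * p) (b + n div 2 * q)"
    and "z \<equiv> quot (a + n * p) (b + n * q)"
  shows "x < y \<and> y < z \<or> z < y \<and> y < x" "\<bar>y - x\<bar> \<le> 2 * \<bar>z - y\<bar>" "\<bar>z - y\<bar> \<le> 2 * \<bar>y - x\<bar>"
proof -
  define k where "k = n div 2"
  from assms have *: "b > 0" "q > 0" "a * q - b * p = -1 \<or> a * q - b * p = 1" "2 \<le> n" "n * q \<le> b" by auto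
  have k: "k \<ge> 1" "k \<le> n - k" "n - k \<le> 2 * k" "k < n" using * by (auto simp: k_def)
  define u where "u = real_of_int k / (real_of_int b * (b + k * q))"
  define w where "w = real_of_int (n - k) / (real_of_int (b + k * q) * (b + n * q))"
  have pos: "0 < real_of_int b + k * q" "0 < real_of_int b + n * q"
    using * k by (auto intro!: add_pos_pos)
  have "u > 0" "w > 0" unfolding u_def w_def using pos * k by auto
  moreover have "u \<le> 2 * w"
  proof -
    \<comment> \<open>From k \<le> n - k and b + n q \<le> 2 b.\<close>
    have "k * (b + n * q) \<le> (n - k) * (2 * b)"
      using * k by (intro mult_mono) auto
    then have "real_of_int (k * (b + n * q)) \<le> real_of_int ((n - k) * (2 * b))"
      by (simp only: of_int_le_iff)
    then show ?thesis
      unfolding u_def w_def using pos * by (simp add: divide_simps) (simp add: algebra_simps)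
  qed
  moreover have "w \<le> 2 * u"
  proof -
    have "(n - k) * b \<le> (2 * k) * (b + n * q)"
      using * k by (intro mult_mono) auto
    then have "real_of_int ((n - k) * b) \<le> real_of_int ((2 * k) * (b + n * q))"
      by (simp only: of_int_le_iff)
    then show ?thesis
      unfolding u_def w_def using pos * by (simp add: divide_simps)
  qed
  moreover have "y - x = u \<and> z - y = w \<or> x - y = u \<and> y - z = w"
    using mediant_order[OF *(1,2) order_refl, of k a p] mediant_order[OF *(1,2), of k n a p] k *(3)
    unfolding x_def y_def z_def u_def w_def k_def[symmetric] by auto
  ultimately show "x < y \<and> y < z \<or> z < y \<and> y < x" "\<bar>y - x\<bar> \<le> 2 * \<bar>z - y\<bar>" "\<bar>z - y\<bar> \<le> 2 * \<bar>y - x\<bar>"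
    by auto
qed

lemma valid_node_left: "valid_node v \<Longrightarrow> valid_node (node_left v)"
proof (induction v)
  case (Tail a b p q)
  have "b div q * q \<le> b" proof -
    have "0 \<le> b mod q" using Tail by simp
    then show ?thesis using minus_mod_eq_div_mult[of b q] by linarith
  qed
  then show ?case
    using Tail by (auto intro!: valid_block simp: pos_imp_zdiv_pos_iff int_one_le_iff_zero_less)
next
  case (Block a b p q n)
  have "n div 2 * q \<le> n * q" using Block by (intro mult_right_mono) auto
  moreover have "n * q \<le> b" using Block by simp
  ultimately have "n div 2 * q \<le> b" by linarith
  then show ?case using Block by (auto intro!: valid_block)
qed

lemma det_shift: "(a + k * p) * q - (b + k * q) * p = a * q - b * (p :: int)"
  by (simp add: algebra_simps)

lemma valid_node_right: "valid_node v \<Longrightarrow> valid_node (node_right v)"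
proof (induction v)
  case (Tail a b p q)
  then have "0 \<le> b div q * q" by (auto simp: pos_imp_zdiv_nonneg_iff)
  then show ?case using Tail by (auto simp: det_shift)
next
  case (Block a b p q n)
  have "(n - n div 2) * q \<le> n * q" using Block by (intro mult_right_mono) auto
  moreover have "0 \<le> n div 2 * q" "n * q \<le> b" using Block by auto
  ultimately have "(n - n div 2) * q \<le> b + n div 2 * q" by linarith
  then show ?case using Block by (auto intro!: valid_block simp: det_shift)
qed

lemma add_mult_diff_collapse:
  "(a + k * p) + (n - k) * p = a + n * (p :: int)"
  by (simp add: algebra_simps)

lemma node_lo_hi_children:
  "node_lo (node_left (Tail a b p q)) = min (quot a b) (quot (a + b div q * p) (b + b div q * q))"
  "node_hi (node_left (Tail a b p q)) = max (quot a b) (quot (a + b div q * p) (b + b div q * q))"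
  "node_lo (node_right (Tail a b p q)) = min (quot (a + b div q * p) (b + b div q * q)) (quot p q)"
  "node_hi (node_right (Tail a b p q)) = max (quot (a + b div q * p) (b + b div q * q)) (quot p q)"
  "node_lo (node_left (Block a b p q n)) = min (quot a b) (quot (a + n div 2 * p) (b + n div 2 * q))"
  "node_hi (node_left (Block a b p q n)) = max (quot a b) (quot (a + n div 2 * p) (b + n div 2 * q))"
  "node_lo (node_right (Block a b p q n)) =
    min (quot (a + n div 2 * p) (b + n div 2 * q)) (quot (a + n * p) (b + n * q))"
  "node_hi (node_right (Block a b p q n)) =
    max (quot (a + n div 2 * p) (b + n div 2 * q)) (quot (a + n * p) (b + n * q))"
  by (simp_all only: node_left.simps node_right.simps block_lo_hi add_mult_diff_collapse of_int_add[symmetric] of_int_mult[symmetric])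
     (simp_all add: node_lo_def node_hi_def)

lemma node_lo_hi_whole:
  "node_lo (Tail a b p q) = min (quot a b) (quot p q)" "node_hi (Tail a b p q) = max (quot a b) (quot p q)"
  "node_lo (Block a b p q n) = min (quot a b) (quot (a + n * p) (b + n * q))"
  "node_hi (Block a b p q n) = max (quot a b) (quot (a + n * p) (b + n * q))"
  by (simp_all add: node_lo_def node_hi_def)

interpretation node: interval_tree valid_node node_left node_right node_lo node_hi
proof
  fix v assume v: "valid_node v"
  show "valid_node (node_left v)" using v by (rule valid_node_left)
  show "valid_node (node_right v)" using v by (rule valid_node_right)
  show "node_lo v < node_hi v"
    using v split_at_point(1)[OF tail_split] split_at_point(1)[OF block_split]
    by (cases v) (simp_all only: node_lo_hi_whole)
  show "node_lo (node_left v) = node_lo v \<and> node_hi (node_left v) = node_lo (node_right v) \<and>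
        node_hi (node_right v) = node_hi v \<or>
      node_lo (node_right v) = node_lo v \<and> node_hi (node_right v) = node_lo (node_left v) \<and>
        node_hi (node_left v) = node_hi v"
    using v split_at_point(2)[OF tail_split] split_at_point(2)[OF block_split]
    by (cases v) (simp_all only: node_lo_hi_whole node_lo_hi_children)
  show "node_hi v - node_lo v \<le> 3 * (node_hi (node_left v) - node_lo (node_left v))"
    using v split_at_point(3)[OF tail_split] split_at_point(3)[OF block_split]
    by (cases v) (simp_all only: node_lo_hi_whole node_lo_hi_children)
  show "node_hi v - node_lo v \<le> 3 * (node_hi (node_right v) - node_lo (node_right v))"
    using v split_at_point(4)[OF tail_split] split_at_point(4)[OF block_split]
    by (cases v) (simp_all only: node_lo_hi_whole node_lo_hi_children)
qed

subsection \<open>The convergence case\<close>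

text \<open>Each point off the support has a null open neighbourhood, and by Lindelof countably many
  of these cover U.\<close>

lemma emeasure_eq_0_if_disjoint_support:
  assumes "locally_finite_borel \<mu>" "open U" "U \<inter> msupport \<mu> = {}"
  shows "emeasure \<mu> U = 0"
proof -
  have sets: "sets \<mu> = sets borel" using assms(1) by (simp add: locally_finite_borel_def)
  let ?F = "{V. open V \<and> emeasure \<mu> V = 0}"
  have "open V" if "V \<in> ?F" for V using that by simp
  then obtain F' where F': "F' \<subseteq> ?F" "countable F'" "\<Union>F' = \<Union>?F"
    by (rule Lindelof)
  have "U \<subseteq> \<Union>?F"
  proof
    fix x assume "x \<in> U"
    then have "x \<notin> msupport \<mu>" using assms(3) by auto
    then obtain V where "open V" "x \<in> V" "\<not> emeasure \<mu> V > 0" unfolding msupport_def by auto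
    then show "x \<in> \<Union>?F" by (intro UnionI[of V]) (auto simp: zero_less_iff_neq_zero)
  qed
  then have "U \<subseteq> \<Union>F'" unfolding F'(3) .
  moreover have "(\<Union>V\<in>F'. V) \<in> null_sets \<mu>"
  proof (rule null_sets_UN'[OF F'(2)])
    fix V assume "V \<in> F'"
    then show "V \<in> null_sets \<mu>" using F'(1) by (auto simp: null_sets_def sets)
  qed
  ultimately have "U \<in> null_sets \<mu>"
    using assms(2) by (intro null_sets_subset[of "\<Union>F'" \<mu> U]) (simp_all add: sets)
  then show ?thesis by (rule null_setsD1)
qed

text \<open>The centre x may lie off the support. If the small ball contains a support point y, then
  B(x, \<epsilon> r) lies in B(y, 2 \<epsilon> r) and, for \<epsilon> < 1/4, B(y, r/2) lies in B(x,
  r); regularity at y compares the two balls.\<close>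

lemma ahlfors_regular_imp_absolutely_decaying:
  assumes "ahlfors_regular \<alpha> \<mu>" "0 < \<alpha>"
  shows "absolutely_decaying \<alpha> \<mu>"
proof -
  from assms obtain C1 C2 where C: "C1 > 0" "C2 > 0" and lf: "locally_finite_borel \<mu>"
    and reg: "\<And>x r. x \<in> msupport \<mu> \<Longrightarrow> 0 < r \<Longrightarrow> r \<le> 1 \<Longrightarrow>
        ennreal (C1 * r powr \<alpha>) \<le> emeasure \<mu> (ball x r) \<and>
        emeasure \<mu> (ball x r) \<le> ennreal (C2 * r powr \<alpha>)"
    unfolding ahlfors_regular_def by auto
  have sets: "sets \<mu> = sets borel" using lf by (simp add: locally_finite_borel_def)
  \<comment> \<open>The factor \<open>4 powr \<alpha>\<close> comes from the quotient 4\<epsilon> of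
    the radii at y; the summand 1 covers \<epsilon> \<ge> 1/4, where monotonicity suffices.\<close>
  define C where "C = 4 powr \<alpha> * (1 + C2 / C1)"
  have "C > 0" using C by (simp add: C_def add_pos_pos)
  moreover have "emeasure \<mu> (ball x (\<epsilon> * r)) \<le> ennreal (C * \<epsilon> powr \<alpha>) * emeasure \<mu> (ball x r)"
    if r: "0 < r" "r \<le> 1" and e: "0 < \<epsilon>" "\<epsilon> \<le> 1" for x r \<epsilon>
  proof (cases "\<epsilon> < 1/4")
    case False
    have "1 \<le> (4 * \<epsilon>) powr \<alpha>" using False assms(2) by (intro ge_one_powr_ge_zero) auto
    also have "\<dots> = 4 powr \<alpha> * \<epsilon> powr \<alpha>" using e by (simp add: powr_mult)
    also have "\<dots> \<le> C * \<epsilon> powr \<alpha>" unfolding C_def using C by (intro mult_right_mono) auto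
    finally have c: "1 \<le> ennreal (C * \<epsilon> powr \<alpha>)" by (simp add: ennreal_leI flip: ennreal_1)
    have "emeasure \<mu> (ball x (\<epsilon> * r)) \<le> emeasure \<mu> (ball x r)"
      using e r by (intro emeasure_mono) (auto simp: sets mult_le_cancel_right1 intro!: subset_ball)
    also have "\<dots> \<le> ennreal (C * \<epsilon> powr \<alpha>) * emeasure \<mu> (ball x r)"
      using mult_right_mono[OF c, of "emeasure \<mu> (ball x r)"] by simp
    finally show ?thesis .
  next
    case True
    show ?thesis
    proof (cases "ball x (\<epsilon> * r) \<inter> msupport \<mu> = {}")
      case True
      then show ?thesis using emeasure_eq_0_if_disjoint_support[OF lf open_ball] by simp
    next
      case False
      then obtain y where y: "y \<in> msupport \<mu>" "dist x y < \<epsilon> * r" by auto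
      have er: "\<epsilon> * r \<le> r / 4" using True r by simp
      have "emeasure \<mu> (ball x (\<epsilon> * r)) \<le> emeasure \<mu> (ball y (2 * (\<epsilon> * r)))"
        using y by (intro emeasure_mono) (auto simp: sets dist_real_def)
      also have "\<dots> \<le> ennreal (C2 * (2 * (\<epsilon> * r)) powr \<alpha>)"
        using reg[OF y(1), of "2 * (\<epsilon> * r)"] e r er by simp
      also have "C2 * (2 * (\<epsilon> * r)) powr \<alpha> = (4 powr \<alpha> * (C2 / C1) * \<epsilon> powr \<alpha>) * (C1 * (r / 2) powr \<alpha>)"
      proof -
        have "(2 * (\<epsilon> * r)) powr \<alpha> = (4 * \<epsilon> * (r / 2)) powr \<alpha>" by simp
        also have "\<dots> = 4 powr \<alpha> * \<epsilon> powr \<alpha> * (r / 2) powr \<alpha>" using e r by (simp only: powr_mult)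
        finally show ?thesis using C by simp
      qed
      also have "\<dots> \<le> (C * \<epsilon> powr \<alpha>) * (C1 * (r / 2) powr \<alpha>)"
        unfolding C_def using C by (intro mult_right_mono mult_left_mono) auto
      also have "ennreal \<dots> = ennreal (C * \<epsilon> powr \<alpha>) * ennreal (C1 * (r / 2) powr \<alpha>)"
        using C \<open>C > 0\<close> by (intro ennreal_mult) auto
      also have "\<dots> \<le> ennreal (C * \<epsilon> powr \<alpha>) * emeasure \<mu> (ball y (r / 2))"
        using reg[OF y(1), of "r / 2"] r by (intro mult_left_mono) auto
      also have "\<dots> \<le> ennreal (C * \<epsilon> powr \<alpha>) * emeasure \<mu> (ball x r)"
      proof (intro mult_left_mono emeasure_mono subsetI)
        fix z assume "z \<in> ball y (r / 2)"
        then have "dist y z < r / 2" by simp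
        then show "z \<in> ball x r" unfolding mem_ball using y(2) er r dist_triangle[of x z y] by linarith
      qed (auto simp: sets)
      finally show ?thesis by (simp add: ennreal_leI)
    qed
  qed
  ultimately show ?thesis unfolding absolutely_decaying_def using lf by blast
qed

lemma absolutely_decaying_finite:
  assumes "absolutely_decaying \<alpha> \<mu>" "finite_measure \<mu>"
  obtains C where "C > 0"
    "\<And>x r \<epsilon>. 0 < r \<Longrightarrow> r \<le> 1 \<Longrightarrow> 0 < \<epsilon> \<Longrightarrow> \<epsilon> \<le> 1 \<Longrightarrow>
      measure \<mu> (ball x (\<epsilon> * r)) \<le> C * \<epsilon> powr \<alpha> * measure \<mu> (ball x r)"
proof -
  interpret finite_measure \<mu> by fact
  obtain C where C: "C > 0" "\<And>x r \<epsilon>. 0 < r \<Longrightarrow> r \<le> 1 \<Longrightarrow> 0 < \<epsilon> \<Longrightarrow> \<epsilon> \<le> 1 \<Longrightarrow>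
      emeasure \<mu> (ball x (\<epsilon> * r)) \<le> ennreal (C * \<epsilon> powr \<alpha>) * emeasure \<mu> (ball x r)"
    using assms(1) unfolding absolutely_decaying_def by auto
  have "measure \<mu> (ball x (\<epsilon> * r)) \<le> C * \<epsilon> powr \<alpha> * measure \<mu> (ball x r)"
    if "0 < r" "r \<le> 1" "0 < \<epsilon>" "\<epsilon> \<le> 1" for x r \<epsilon>
    using C(2)[OF that, of x] C(1) by (simp add: emeasure_eq_measure flip: ennreal_mult)
  with C(1) show ?thesis by (rule that)
qed

text \<open>Letting \<epsilon> tend to 0 in the decay condition excludes atoms, and the rationals
  are countable.\<close>

lemma AE_irrational:
  assumes ad: "absolutely_decaying \<alpha> \<mu>" and fin: "finite_measure \<mu>" and \<alpha>: "0 < \<alpha>"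
  shows "AE x in \<mu>. x \<notin> \<rat>"
proof -
  interpret finite_measure \<mu> by fact
  have sets: "sets \<mu> = sets borel" using ad by (simp add: absolutely_decaying_def locally_finite_borel_def)
  have "{x} \<in> null_sets \<mu>" for x
  proof -
    obtain C where C: "C > 0" "\<And>x r \<epsilon>. 0 < r \<Longrightarrow> r \<le> 1 \<Longrightarrow> 0 < \<epsilon> \<Longrightarrow> \<epsilon> \<le> 1 \<Longrightarrow>
      measure \<mu> (ball x (\<epsilon> * r)) \<le> C * \<epsilon> powr \<alpha> * measure \<mu> (ball x r)"
      using absolutely_decaying_finite[OF ad fin] by metis
    have bound: "measure \<mu> {x} \<le> C * \<epsilon> powr \<alpha> * measure \<mu> (ball x 1)" if "0 < \<epsilon>" "\<epsilon> \<le> 1" for \<epsilon>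
    proof -
      have "measure \<mu> {x} \<le> measure \<mu> (ball x (\<epsilon> * 1))"
        using that by (intro finite_measure_mono) (auto simp: sets)
      also have "\<dots> \<le> C * \<epsilon> powr \<alpha> * measure \<mu> (ball x 1)" using C(2)[of 1 \<epsilon> x] that by simp
      finally show ?thesis .
    qed
    have "eventually (\<lambda>\<epsilon>::real. 0 \<le> \<epsilon>) (at_right 0)"
      unfolding eventually_at_right_field by (intro exI[of _ 1]) auto
    then have "((\<lambda>\<epsilon>::real. \<epsilon> powr \<alpha>) \<longlongrightarrow> 0) (at_right 0)"
      using \<alpha> by (intro tendsto_zero_powrI[where b=\<alpha>] tendsto_ident_at tendsto_const)
    then have "((\<lambda>\<epsilon>. C * \<epsilon> powr \<alpha> * measure \<mu> (ball x 1)) \<longlongrightarrow> C * 0 * measure \<mu> (ball x 1)) (at_right 0)"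
      by (intro tendsto_intros)
    moreover have "\<forall>\<^sub>F \<epsilon> in at_right 0. measure \<mu> {x} \<le> C * \<epsilon> powr \<alpha> * measure \<mu> (ball x 1)"
      using bound unfolding eventually_at_right_field by (intro exI[of _ 1]) auto
    ultimately have "measure \<mu> {x} \<le> C * 0 * measure \<mu> (ball x 1)"
      by (rule tendsto_lowerbound) simp
    then have "measure \<mu> {x} = 0" using measure_nonneg[of \<mu> "{x}"] by simp
    then show ?thesis by (simp add: null_sets_def sets emeasure_eq_measure)
  qed
  then have "(\<Union>x\<in>\<rat>. {x}) \<in> null_sets \<mu>"
    by (intro null_sets_UN' countable_rat)
  then show ?thesis by (intro AE_I'[of \<rat>]) auto
qed

section \<open>Separated rationals and Borel--Cantelli over dyadic ranges of denominators\<close>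

lemma rational_separation:
  fixes p p' :: int and q q' :: nat
  assumes "q \<ge> 1" "q' \<ge> 1" "coprime p (int q)" "coprime p' (int q')" "(p, q) \<noteq> (p', q')"
  shows "1 / (real q * real q') \<le> \<bar>real_of_int p / real q - real_of_int p' / real q'\<bar>"
proof -
  have ne: "p * int q' \<noteq> p' * int q"
  proof
    assume *: "p * int q' = p' * int q"
    have "int q dvd int q'"
      using * assms(3) by (metis coprime_commute coprime_dvd_mult_right_iff dvd_triv_right)
    moreover have "int q' dvd int q"
      using * assms(4) by (metis coprime_commute coprime_dvd_mult_right_iff dvd_triv_right)
    ultimately have "q = q'" by (simp add: dvd_antisym)
    then show False using * assms by auto
  qed
  then have "1 \<le> \<bar>p * int q' - p' * int q\<bar>" by auto
  then have "1 \<le> \<bar>real_of_int (p * int q' - p' * int q)\<bar>" by linarith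
  moreover have "real_of_int p / real q - real_of_int p' / real q' =
      real_of_int (p * int q' - p' * int q) / (real q * real q')"
    using assms by (simp add: field_simps)
  ultimately show ?thesis using assms by (simp add: abs_divide divide_right_mono)
qed

text \<open>Cauchy condensation: the terms are
  \<open>((real q)\<^sup>2 * \<psi> q) powr \<alpha> / real q\<close>, which is nonincreasing in
  q.\<close>

lemma summable_iff_dyadic:
  fixes \<psi> :: "nat \<Rightarrow> real"
  assumes pos: "\<forall>q\<ge>1. \<psi> q > 0" and anti: "antimono_on {1..} (\<lambda>q. (real q)\<^sup>2 * \<psi> q)" and \<alpha>: "0 < \<alpha>"
  shows "summable (\<lambda>n. real (Suc n) powr (2 * \<alpha> - 1) * \<psi> (Suc n) powr \<alpha>) \<longleftrightarrow>
    summable (\<lambda>n. ((2 ^ n)\<^sup>2 * \<psi> (2 ^ n)) powr \<alpha>)"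
proof -
  define G where "G q = (if q = 0 then 0 else ((real q)\<^sup>2 * \<psi> q) powr \<alpha> / real q)" for q
  have "real (Suc n) powr (2 * \<alpha> - 1) * \<psi> (Suc n) powr \<alpha> = G (Suc n)" for n
  proof -
    have "((real (Suc n))\<^sup>2 * \<psi> (Suc n)) powr \<alpha> = ((real (Suc n)) powr 2) powr \<alpha> * \<psi> (Suc n) powr \<alpha>"
      using pos by (subst powr_mult[symmetric]) (auto simp: powr_numeral)
    also have "((real (Suc n)) powr 2) powr \<alpha> = real (Suc n) powr (2 * \<alpha>)" by (rule powr_powr)
    finally show ?thesis by (simp add: G_def powr_diff)
  qed
  then have "summable (\<lambda>n. real (Suc n) powr (2 * \<alpha> - 1) * \<psi> (Suc n) powr \<alpha>) \<longleftrightarrow>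
      summable (\<lambda>n. G (Suc n))" by simp
  also have "\<dots> \<longleftrightarrow> summable G" by (rule summable_Suc_iff)
  also have "\<dots> \<longleftrightarrow> summable (\<lambda>n. 2 ^ n * G (2 ^ n))"
  proof (rule condensation_test)
    fix m :: nat assume m: "0 < m"
    have "(real (Suc m))\<^sup>2 * \<psi> (Suc m) \<le> (real m)\<^sup>2 * \<psi> m"
      using monotone_onD[OF anti, of m "Suc m"] m by simp
    moreover have "0 \<le> (real (Suc m))\<^sup>2 * \<psi> (Suc m)" using pos by (auto simp: less_imp_le)
    ultimately have "((real (Suc m))\<^sup>2 * \<psi> (Suc m)) powr \<alpha> \<le> ((real m)\<^sup>2 * \<psi> m) powr \<alpha>"
      using \<alpha> by (intro powr_mono2) auto
    then show "G (Suc m) \<le> G m" using m unfolding G_def by (auto intro!: frac_le)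
  qed (simp add: G_def)
  also have "(\<lambda>n. 2 ^ n * G (2 ^ n)) = (\<lambda>n. ((2 ^ n)\<^sup>2 * \<psi> (2 ^ n)) powr \<alpha>)"
    by (simp add: G_def)
  finally show ?thesis .
qed

lemma finite_approximants_bounded_denominator:
  "finite {(p :: int, q :: nat). 1 \<le> q \<and> q < Q \<and> \<bar>x - real_of_int p / real q\<bar> \<le> \<psi> q}"
proof (rule finite_subset)
  show "{(p :: int, q :: nat). 1 \<le> q \<and> q < Q \<and> \<bar>x - real_of_int p / real q\<bar> \<le> \<psi> q} \<subseteq>
    (\<Union>q<Q. {\<lfloor>(x - \<psi> q) * real q\<rfloor>..\<lceil>(x + \<psi> q) * real q\<rceil>} \<times> {q})"
  proof clarsimp
    fix p :: int and q :: nat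
    assume q: "Suc 0 \<le> q" "\<bar>x - real_of_int p / real q\<bar> \<le> \<psi> q"
    then have "x - \<psi> q \<le> real_of_int p / real q" "real_of_int p / real q \<le> x + \<psi> q" by linarith+
    then have "(x - \<psi> q) * real q \<le> p" "p \<le> (x + \<psi> q) * real q"
      using q(1) by (simp_all add: le_divide_eq divide_le_eq)
    then show "\<lfloor>(x - \<psi> q) * real q\<rfloor> \<le> p \<and> p \<le> \<lceil>(x + \<psi> q) * real q\<rceil>" by linarith
  qed
qed auto

theorem AE_not_psi_approximable:
  fixes \<psi> :: "nat \<Rightarrow> real"
  assumes ad: "absolutely_decaying \<alpha> \<mu>" and fin: "finite_measure \<mu>"
    and supp: "AE x in \<mu>. x \<in> {0..1}" and \<alpha>: "0 < \<alpha>"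
    and pos: "\<forall>q\<ge>1. \<psi> q > 0" and anti: "antimono_on {1..} (\<lambda>q. (real q)\<^sup>2 * \<psi> q)"
    and sum: "summable (\<lambda>n. real (Suc n) powr (2 * \<alpha> - 1) * \<psi> (Suc n) powr \<alpha>)"
  shows "AE x in \<mu>. \<not> psi_approximable \<psi> x"
proof -
  interpret finite_measure \<mu> by fact
  have sets: "sets \<mu> = sets borel" using ad by (simp add: absolutely_decaying_def locally_finite_borel_def)
  obtain C where C: "C > 0" "\<And>x r \<epsilon>. 0 < r \<Longrightarrow> r \<le> 1 \<Longrightarrow> 0 < \<epsilon> \<Longrightarrow> \<epsilon> \<le> 1 \<Longrightarrow>
      measure \<mu> (ball x (\<epsilon> * r)) \<le> C * \<epsilon> powr \<alpha> * measure \<mu> (ball x r)"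
    using absolutely_decaying_finite[OF ad fin] by metis
  define g where "g n = (2 ^ n)\<^sup>2 * \<psi> (2 ^ n)" for n :: nat
  have gpos: "g n > 0" for n using pos by (simp add: g_def)
  have gsum: "summable (\<lambda>n. g n powr \<alpha>)"
    unfolding g_def using sum summable_iff_dyadic[OF pos anti \<alpha>] by simp
  have \<psi>_le: "\<psi> q \<le> g n / 4 ^ n" if "2 ^ n \<le> q" for q n
  proof -
    have q: "1 \<le> q" using that by (meson one_le_numeral one_le_power order_trans)
    have "(real q)\<^sup>2 * \<psi> q \<le> g n"
      using monotone_onD[OF anti, of "2 ^ n" q] that q by (simp add: g_def)
    moreover have "4 ^ n \<le> (real q)\<^sup>2"
    proof -
      have "(2::real) ^ n \<le> real q" using that by (metis of_nat_le_iff of_nat_numeral of_nat_power)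
      then have "((2::real) ^ n)\<^sup>2 \<le> (real q)\<^sup>2" by (rule power_mono) simp
      moreover have "((2::real) ^ n)\<^sup>2 = 4 ^ n" by (simp flip: power_mult_distrib add: power2_eq_square)
      ultimately show ?thesis by simp
    qed
    then have "4 ^ n * \<psi> q \<le> (real q)\<^sup>2 * \<psi> q" using pos q by (intro mult_right_mono) (auto simp: less_imp_le)
    ultimately show ?thesis by (simp add: field_simps)
  qed
  \<comment> \<open>From some N on, \<open>16 * g n\<close> is below 1 and may serve as the ratio
    \<epsilon> of the decay condition.\<close>
  have "(\<lambda>n. g n powr \<alpha>) \<longlonglongrightarrow> 0" by (rule summable_LIMSEQ_zero[OF gsum])
  then have "eventually (\<lambda>n. g n powr \<alpha> < (1/16) powr \<alpha>) sequentially"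
    by (intro order_tendstoD(2)[where y=0]) auto
  then obtain N where N: "\<And>n. n \<ge> N \<Longrightarrow> g n powr \<alpha> < (1/16) powr \<alpha>" by (auto simp: eventually_sequentially)
  have small: "g n < 1/16" if "n \<ge> N" for n
    using N[OF that] powr_mono2[of \<alpha> "1/16" "g n"] \<alpha> by (cases "g n < 1/16") auto
  \<comment> \<open>Numerators between -2q and 2q suffice, because x lies in [0, 1] and the
    approximants in question are within 1 of x.\<close>
  define I where "I n = {(p :: int, q :: nat). q \<in> {2 ^ n..<2 ^ Suc n} \<and> p \<in> {- 2 * int q..2 * int q} \<and>
      coprime p (int q)}" for n :: nat
  \<comment> \<open>Distinct rationals with denominators below 2^(n+1) are at least
    \<open>1 / (4 * 4 ^ n) = 2 * r n\<close> apart. The radius \<open>16 * g n * r n\<close> is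
    twice the bound \<open>g n / 4 ^ n\<close> on \<psi>, which leaves room for open balls.\<close>
  define r where "r n = 1 / (8 * 4 ^ n :: real)" for n :: nat
  define A where "A n = (if n < N then {} else
      (\<Union>(p, q)\<in>I n. ball (real_of_int p / real q) (16 * g n * r n)))" for n
  have finI: "finite (I n)" for n
  proof (rule finite_subset)
    show "I n \<subseteq> {- 2 * 2 ^ Suc n..2 * 2 ^ Suc n} \<times> {..2 ^ Suc n}"
    proof clarify
      fix p :: int and q :: nat assume "(p, q) \<in> I n"
      then have *: "- 2 * int q \<le> p" "p \<le> 2 * int q" "q < 2 ^ Suc n" by (auto simp: I_def)
      then have "int q \<le> 2 ^ Suc n" by (metis less_imp_le of_nat_le_iff of_nat_numeral of_nat_power)
      with * show "p \<in> {- 2 * 2 ^ Suc n..2 * 2 ^ Suc n} \<and> q \<in> {..2 ^ Suc n}" by auto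
    qed
  qed auto
  have rn: "0 < r n" "r n \<le> 1" for n
  proof -
    have "(1::real) \<le> 4 ^ n" by simp
    then have "(1::real) \<le> 8 * 4 ^ n" by linarith
    then show "0 < r n" "r n \<le> 1" unfolding r_def by (simp_all add: divide_le_eq)
  qed
  have disj: "disjoint_family_on (\<lambda>(p, q). ball (real_of_int p / real q) (r n)) (I n)" for n
  proof (unfold disjoint_family_on_def, intro ballI impI)
    fix a b assume ab: "a \<in> I n" "b \<in> I n" "a \<noteq> b"
    obtain p q p' q' where eq: "a = (p, q)" "b = (p', q')" by (cases a, cases b)
    have q: "1 \<le> q" "1 \<le> q'" "q < 2 ^ Suc n" "q' < 2 ^ Suc n" "coprime p (int q)" "coprime p' (int q')"
      using ab order_trans[OF one_le_power[of "2 :: nat" n]] unfolding eq I_def by auto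
    have "real m \<le> 2 ^ Suc n" if "m < 2 ^ Suc n" for m
      using that by (metis less_imp_le of_nat_le_iff of_nat_numeral of_nat_power)
    then have "real q * real q' \<le> 2 ^ Suc n * 2 ^ Suc n"
      using q by (intro mult_mono) auto
    also have "(2::real) ^ Suc n * 2 ^ Suc n = 4 * 4 ^ n" by (simp flip: power_mult_distrib)
    finally have "1 / (4 * 4 ^ n) \<le> 1 / (real q * real q')"
      using q by (intro divide_left_mono) auto
    also have "\<dots> \<le> \<bar>real_of_int p / real q - real_of_int p' / real q'\<bar>"
      using rational_separation[OF q(1,2,5,6)] ab(3) by (simp add: eq)
    finally have "2 * r n \<le> \<bar>real_of_int p / real q - real_of_int p' / real q'\<bar>"
      by (simp add: r_def)
    then have "ball (real_of_int p / real q) (r n) \<inter> ball (real_of_int p' / real q') (r n) = {}"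
      by (intro disjoint_ballI) (simp add: dist_real_def)
    then show "(case a of (p, q) \<Rightarrow> ball (real_of_int p / real q) (r n)) \<inter>
        (case b of (p, q) \<Rightarrow> ball (real_of_int p / real q) (r n)) = {}"
      by (simp add: eq)
  qed
  have A_sets: "A n \<in> sets \<mu>" for n
    unfolding A_def sets by (auto intro!: borel_open open_UN)
  have A_le: "measure \<mu> (A n) \<le> C * 16 powr \<alpha> * measure \<mu> (space \<mu>) * g n powr \<alpha>" for n
  proof (cases "n < N")
    case True
    then show ?thesis using C(1) by (simp add: A_def)
  next
    case False
    then have e: "0 < 16 * g n" "16 * g n \<le> 1" using small[of n] gpos[of n] by auto
    have "measure \<mu> (A n) \<le> (\<Sum>(p, q)\<in>I n. measure \<mu> (ball (real_of_int p / real q) (16 * g n * r n)))"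
      unfolding A_def using False finI[of n]
      by (auto simp: case_prod_unfold sets intro!: measure_UNION_le)
    also have "\<dots> \<le> (\<Sum>(p, q)\<in>I n. C * (16 * g n) powr \<alpha> * measure \<mu> (ball (real_of_int p / real q) (r n)))"
      using C(2)[OF rn e] by (intro sum_mono) (auto split: prod.splits)
    also have "\<dots> = C * (16 * g n) powr \<alpha> * (\<Sum>(p, q)\<in>I n. measure \<mu> (ball (real_of_int p / real q) (r n)))"
      by (simp add: sum_distrib_left case_prod_unfold)
    also have "(\<Sum>(p, q)\<in>I n. measure \<mu> (ball (real_of_int p / real q) (r n))) =
        measure \<mu> (\<Union>(p, q)\<in>I n. ball (real_of_int p / real q) (r n))"
      using finite_measure_finite_Union[OF finI _ disj, of n] by (simp add: case_prod_unfold sets image_subset_iff)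
    also have "C * (16 * g n) powr \<alpha> * \<dots> \<le> C * (16 * g n) powr \<alpha> * measure \<mu> (space \<mu>)"
      using C(1) by (intro mult_left_mono bounded_measure) auto
    also have "\<dots> = C * 16 powr \<alpha> * measure \<mu> (space \<mu>) * g n powr \<alpha>"
      using gpos[of n] by (simp add: powr_mult)
    finally show ?thesis .
  qed
  have "summable (\<lambda>n. measure \<mu> (A n))"
    by (rule summable_comparison_test'[OF summable_mult[OF gsum, of "C * 16 powr \<alpha> * measure \<mu> (space \<mu>)"], of 0])
      (use A_le in auto)
  then have "AE x in \<mu>. eventually (\<lambda>n. x \<in> space \<mu> - A n) sequentially"
    by (intro borel_cantelli_AE1 A_sets) (auto simp: less_top[symmetric])
  then show ?thesis
    using supp
  proof eventually_elim
    case (elim x)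
    then obtain M where M: "\<And>n. n \<ge> M \<Longrightarrow> x \<notin> A n" by (auto simp: eventually_sequentially)
    define K where "K = max M N"
    show "\<not> psi_approximable \<psi> x"
    proof
      assume "psi_approximable \<psi> x"
      then have inf: "infinite {(p :: int, q :: nat). q \<ge> 1 \<and> coprime p (int q) \<and>
         \<bar>x - of_int p / of_nat q\<bar> \<le> \<psi> q}" (is "infinite ?S")
        by (simp add: psi_approximable_def)
      have "\<not> ?S \<subseteq> {(p :: int, q :: nat). 1 \<le> q \<and> q < 2 ^ K \<and> \<bar>x - real_of_int p / real q\<bar> \<le> \<psi> q}"
        using inf finite_approximants_bounded_denominator finite_subset by blast
      then obtain p q where "(p, q) \<in> ?S"
        "(p, q) \<notin> {(p, q). 1 \<le> q \<and> q < 2 ^ K \<and> \<bar>x - real_of_int p / real q\<bar> \<le> \<psi> q}" by auto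
      then have pq: "q \<ge> 1" "coprime p (int q)" "\<bar>x - real_of_int p / real q\<bar> \<le> \<psi> q" "2 ^ K \<le> q"
        by auto
      obtain n where n: "2 ^ n \<le> q" "q < 2 ^ Suc n"
        using ex_power_ivl1[of 2 q] pq(1) by auto
      have "2 ^ K < (2 ^ Suc n :: nat)" using pq(4) n(2) by linarith
      then have "K \<le> n" by (simp del: power_Suc)
      then have nMN: "n \<ge> M" "n \<ge> N" by (auto simp: K_def)
      have d: "\<bar>x - real_of_int p / real q\<bar> \<le> g n / 4 ^ n" using pq(3) \<psi>_le[OF n(1)] by simp
      also have "\<dots> < 16 * g n * r n" using gpos[of n] by (simp add: r_def divide_strict_right_mono)
      finally have ball: "x \<in> ball (real_of_int p / real q) (16 * g n * r n)"
        by (simp add: dist_real_def abs_minus_commute)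
      have "g n / 4 ^ n \<le> g n / 1" using gpos[of n] by (intro divide_left_mono) auto
      then have "\<bar>x - real_of_int p / real q\<bar> \<le> 1" using d small[OF nMN(2)] by simp
      then have "- 2 \<le> real_of_int p / real q" "real_of_int p / real q \<le> 2" using elim(2) by (auto simp: abs_le_iff)
      then have "real_of_int (- 2 * int q) \<le> real_of_int p" "real_of_int p \<le> real_of_int (2 * int q)"
        using pq(1) by (simp_all add: le_divide_eq divide_le_eq)
      then have "(p, q) \<in> I n"
        using n pq(2) by (simp add: I_def del: power_Suc of_int_mult of_int_minus)
      then have "x \<in> A n" using ball nMN(2) by (auto simp: A_def intro!: bexI[of _ "(p, q)"])
      then show False using M[OF nMN(1)] by simp
    qed
  qed
qed

subsection \<open>The divergence case\<close>

text \<open>In a block of l consecutive indices each term is at most the first one, which belongs to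
  the subsequence.\<close>

lemma summable_if_subsequence_summable:
  fixes h :: "nat \<Rightarrow> real"
  assumes "antimono h" "\<And>n. 0 \<le> h n" "1 \<le> l" "summable (\<lambda>k. h (k * l))"
  shows "summable h"
proof (rule summableI_nonneg_bounded)
  fix n
  have "n \<le> n * l" using assms(3) by simp
  then have "sum h {..<n} \<le> sum h {..<n * l}" using assms(2) by (intro sum_mono2) auto
  also have "\<dots> = (\<Sum>k<n. sum h {k * l..<k * l + l})" by (rule sum.nat_group[symmetric])
  also have "\<dots> \<le> (\<Sum>k<n. real l * h (k * l))"
  proof (rule sum_mono)
    fix k
    have "sum h {k * l..<k * l + l} \<le> (\<Sum>i\<in>{k * l..<k * l + l}. h (k * l))"
      using assms(1) by (intro sum_mono) (auto simp: antimono_def)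
    then show "sum h {k * l..<k * l + l} \<le> real l * h (k * l)" by simp
  qed
  also have "\<dots> = real l * (\<Sum>k<n. h (k * l))" by (simp add: sum_distrib_left)
  also have "\<dots> \<le> real l * suminf (\<lambda>k. h (k * l))"
    using assms by (intro mult_left_mono sum_le_suminf) auto
  finally show "sum h {..<n} \<le> real l * suminf (\<lambda>k. h (k * l))" .
qed (use assms in auto)

text \<open>If the truncated series converged, its terms would tend to 0, so the truncation at 1
  would eventually be inactive.\<close>

lemma not_summable_truncated_subsequence:
  fixes \<psi> :: "nat \<Rightarrow> real"
  assumes pos: "\<forall>q\<ge>1. \<psi> q > 0" and anti: "antimono_on {1..} (\<lambda>q. (real q)\<^sup>2 * \<psi> q)" and \<alpha>: "0 < \<alpha>"
    and div: "\<not> summable (\<lambda>n. real (Suc n) powr (2 * \<alpha> - 1) * \<psi> (Suc n) powr \<alpha>)" and l: "1 \<le> l"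
  shows "\<not> summable (\<lambda>k. (min 1 ((2 ^ (k * l))\<^sup>2 * \<psi> (2 ^ (k * l)))) powr \<alpha>)"
proof
  define g where "g n = (2 ^ n)\<^sup>2 * \<psi> (2 ^ n)" for n :: nat
  have gpos: "g n > 0" for n using pos by (simp add: g_def)
  have ganti: "g n \<le> g m" if "m \<le> n" for m n
    using monotone_onD[OF anti, of "2 ^ m" "2 ^ n"] that by (simp add: g_def)
  assume "summable (\<lambda>k. (min 1 ((2 ^ (k * l))\<^sup>2 * \<psi> (2 ^ (k * l)))) powr \<alpha>)"
  then have "summable (\<lambda>k. (min 1 (g (k * l))) powr \<alpha>)" by (simp add: g_def)
  moreover have "antimono (\<lambda>n. (min 1 (g n)) powr \<alpha>)"
    using gpos \<alpha> ganti by (intro antimonoI powr_mono2 min.mono) (simp_all add: less_imp_le)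
  ultimately have s: "summable (\<lambda>n. (min 1 (g n)) powr \<alpha>)"
    using summable_if_subsequence_summable[OF _ _ l, of "\<lambda>n. (min 1 (g n)) powr \<alpha>"] by simp
  then have "eventually (\<lambda>n. (min 1 (g n)) powr \<alpha> < 1) sequentially"
    by (intro order_tendstoD(2)[OF summable_LIMSEQ_zero[OF s]]) simp
  then have "eventually (\<lambda>n. (min 1 (g n)) powr \<alpha> = g n powr \<alpha>) sequentially"
    by eventually_elim (auto simp: min_def split: if_splits)
  then have "summable (\<lambda>n. g n powr \<alpha>)" using summable_cong s by fast
  then show False using div summable_iff_dyadic[OF pos anti \<alpha>] by (simp add: g_def)
qed

text \<open>Every tail that arises from a block of a single digit is fresh.\<close>

definition fresh :: "int \<Rightarrow> int \<Rightarrow> int \<Rightarrow> int \<Rightarrow> bool" where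
  "fresh a b p q \<longleftrightarrow> valid_node (Tail a b p q) \<and> q < b \<and> b \<le> 2 * q"

section \<open>Propagation of mass bounds through one digit\<close>

locale cf_measure =
  fixes \<alpha> :: real
  assumes exponent_pos: "0 < \<alpha>" and exponent_le_1: "\<alpha> \<le> 1"
begin

sublocale thermostat valid_node node_left node_right node_lo node_hi \<alpha>
  by unfold_locales (use exponent_pos exponent_le_1 in auto)

lemma mass_UNIV: "valid_node v \<Longrightarrow> 1/2 \<le> c \<Longrightarrow> c \<le> 3 \<Longrightarrow> mass v c UNIV = c * (node_hi v - node_lo v) powr \<alpha>"
  by (rule mass_hull) auto

lemma tail_mass:
  assumes "valid_node (Tail a b p q)" "1/2 \<le> c" "c \<le> 3"
  shows "mass (Tail a b p q) c UNIV = c * (real_of_int q powr - \<alpha> * real_of_int b powr - \<alpha>)"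
  using assms(1) unfolding mass_UNIV[OF assms] tail_len[OF assms(1)]
  by (simp add: powr_minus powr_divide powr_mult field_simps)

text \<open>Repeated halving of a block ends in single digits, which are fresh tails with
  denominators from b to at most Q. Masses add up on the way and H is uniform in the density, so the
  proportion K is inherited even where parts are dropped.\<close>

lemma block_mass_le:
  assumes B: "B \<in> sets borel"
    and H: "\<And>a b p q c. fresh a b p q \<Longrightarrow> 1/2 \<le> c \<Longrightarrow> c \<le> 3 \<Longrightarrow> q0 \<le> q \<Longrightarrow> q \<le> Q \<Longrightarrow>
      mass (Tail a b p q) c B \<le> K * mass (Tail a b p q) c UNIV"
    and "1 \<le> q" "\<bar>a * q - b * p\<bar> = 1" "1 \<le> n" "n * q \<le> b" "q0 \<le> b" "b + n * q \<le> Q"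
    and "1/2 \<le> c" "c \<le> 3"
  shows "mass (block a b p q n) c B \<le> K * mass (block a b p q n) c UNIV"
  using assms(3-)
proof (induction "nat n" arbitrary: a b p q n c rule: less_induct)
  case less
  have v: "valid_node (block a b p q n)" using less.prems by (intro valid_block)
  show ?case
  proof (cases "n = 1")
    case True
    then have eq: "block a b p q n = Tail (a + p) (b + q) a b" by (simp add: block_def)
    have "fresh (a + p) (b + q) a b"
      using v less.prems True unfolding eq fresh_def by auto
    then show ?thesis unfolding eq using less.prems True by (intro H) auto
  next
    case False
    then have eq: "block a b p q n = Block a b p q n" by (simp add: block_def)
    define k where "k = n div 2"
    have k: "1 \<le> k" "1 \<le> n - k" "k < n" "n - k < n" using less.prems False by (auto simp: k_def)
    have kq: "0 \<le> k * q" "k * q \<le> n * q" "(n - k) * q \<le> n * q"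
      using k less.prems by (auto intro!: mult_right_mono)
    then have k_le: "k * q \<le> b" "b + k * q \<le> Q" using less.prems(4,6) by linarith+
    have l: "node_left (block a b p q n) = block a b p q k"
      and r: "node_right (block a b p q n) = block (a + k * p) (b + k * q) p q (n - k)"
      unfolding eq by (simp_all add: k_def)
    have L: "mass (block a b p q k) c' B \<le> K * mass (block a b p q k) c' UNIV"
      if "1/2 \<le> c'" "c' \<le> 3" for c'
      by (rule less.hyps) (use that less.prems k k_le in auto)
    have R: "mass (block (a + k * p) (b + k * q) p q (n - k)) c' B \<le>
        K * mass (block (a + k * p) (b + k * q) p q (n - k)) c' UNIV"
      if "1/2 \<le> c'" "c' \<le> 3" for c'
    proof (rule less.hyps)
      have "b + k * q + (n - k) * q = b + n * q" by (simp add: algebra_simps)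
      then show "b + k * q + (n - k) * q \<le> Q" using less.prems by simp
      show "(n - k) * q \<le> b + k * q" "q0 \<le> b + k * q" using less.prems kq by linarith+
    qed (use that less.prems k in \<open>auto simp: det_shift\<close>)
    from v less.prems(7,8) show ?thesis
    proof (cases rule: mass_split)
      case (1 c')
      show ?thesis
        using L[OF 1(1,2)] R[OF 1(1,2)] 1(3)[OF B] 1(3)[of UNIV] unfolding l r by (simp add: distrib_left)
    next
      case (2 c')
      show ?thesis
        using R[OF 2(1,2)] 2(3)[OF B] 2(3)[of UNIV] unfolding r by simp
    qed
  qed
qed

text \<open>The remainder of b modulo q is less than q \<le> n q, so b \<le> 2 n q: a step towards
  p/q multiplies b by a factor in [3/2, 2].\<close>

lemma tail_step:
  fixes a b p q :: int
  assumes "valid_node (Tail a b p q)"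
  defines "n \<equiv> b div q"
  shows "1 \<le> n" "n * q \<le> b" "3 * b \<le> 2 * (b + n * q)" "valid_node (Tail (a + n * p) (b + n * q) p q)"
    "valid_node (block a b p q n)"
proof -
  from assms have *: "q > 0" "q \<le> b" "\<bar>a * q - b * p\<bar> = 1" by auto
  show n: "1 \<le> n" using * by (simp add: n_def pos_imp_zdiv_pos_iff int_one_le_iff_zero_less)
  have "b = n * q + b mod q" by (simp add: n_def)
  moreover have "b mod q < q" "0 \<le> b mod q" using * by auto
  moreover have "1 * q \<le> n * q" using * n by (intro mult_right_mono) auto
  ultimately have nq': "n * q \<le> b" "b \<le> 2 * (n * q)" by linarith+
  have "2 * (b + n * q) = 2 * b + 2 * (n * q)" by (simp add: distrib_left)
  then show nq: "n * q \<le> b" "3 * b \<le> 2 * (b + n * q)" using nq' by (simp_all only:)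
  show "valid_node (Tail (a + n * p) (b + n * q) p q)"
    using valid_node_right[OF assms(1)] by (simp add: n_def)
  show "valid_node (block a b p q n)"
    using * n nq by (intro valid_block) auto
qed

lemma tail_mass_split:
  assumes "valid_node (Tail a b p q)" "1/2 \<le> c" "c \<le> 3"
  defines "n \<equiv> b div q"
  obtains c' where "1/2 \<le> c'" "c' \<le> 3"
    "\<And>A. A \<in> sets borel \<Longrightarrow> mass (Tail a b p q) c A =
      mass (block a b p q n) c' A + mass (Tail (a + n * p) (b + n * q) p q) c' A"
  | c' where "1/2 \<le> c'" "c' \<le> 3"
    "\<And>A. A \<in> sets borel \<Longrightarrow> mass (Tail a b p q) c A = mass (Tail (a + n * p) (b + n * q) p q) c' A"
  using mass_split[OF assms(1-3)] unfolding node_left.simps node_right.simps n_def by metis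

text \<open>The bound on the contribution of a block shrinks by the factor \<open>(2/3) powr (\<alpha>/2)\<close> from one tail to the next;
  \<open>kappa\<close> is the sum of the resulting geometric series.\<close>

definition kappa :: real where
  "kappa = 6 / (1 - (2/3) powr (\<alpha>/2))"

lemma kappa_pos: "kappa > 0" and kappa_eq: "6 + kappa * (2/3) powr (\<alpha>/2) = kappa"
proof -
  have "(2/3) powr (\<alpha>/2) < (2/3 :: real) powr 0"
    using exponent_pos by (intro powr_less_mono') auto
  then have *: "(2/3 :: real) powr (\<alpha>/2) < 1" by simp
  then show "kappa > 0" by (simp add: kappa_def)
  show "6 + kappa * (2/3) powr (\<alpha>/2) = kappa" proof -
    define x :: real where "x = (2/3) powr (\<alpha>/2)"
    have "x \<noteq> 1" using * unfolding x_def by linarith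
    then show ?thesis unfolding kappa_def x_def[symmetric] by (simp add: field_simps)
  qed
qed

text \<open>The subtracted term is a lower bound for the mass of the first tail with \<open>b \<ge> Y\<close>, which lies so close to
  \<open>p/q\<close> that it does not meet \<open>B\<close>. The last term controls the growth of the denominators.\<close>

lemma tail_mass_le:
  assumes B: "B \<in> sets borel" and AR: "0 \<le> A" "0 \<le> R"
    and H: "\<And>a b p q c. fresh a b p q \<Longrightarrow> 1/2 \<le> c \<Longrightarrow> c \<le> 3 \<Longrightarrow> q0 \<le> q \<Longrightarrow>
      mass (Tail a b p q) c B \<le> (A + R * q powr (\<alpha>/2)) * mass (Tail a b p q) c UNIV"
    and hit: "\<And>a b c. valid_node (Tail a b p q) \<Longrightarrow> 1/2 \<le> c \<Longrightarrow> c \<le> 3 \<Longrightarrow> Y \<le> b \<Longrightarrow>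
      mass (Tail a b p q) c B = 0"
    and "valid_node (Tail a b p q)" "1/2 \<le> c" "c \<le> 3" "q0 \<le> b" "real_of_int b \<le> 2 * Y"
  shows "mass (Tail a b p q) c B \<le>
    A * (mass (Tail a b p q) c UNIV - 1/2 * (q powr - \<alpha> * (2 * Y) powr - \<alpha>)) +
    kappa * R * (b powr - (\<alpha>/2) * q powr - \<alpha>)"
  using assms(6-)
\<comment> \<open>The induction follows the tails towards p/q until b reaches Y. The bound b \<le>
  2Y persists, because a step from b < Y at most doubles b.\<close>
proof (induction "nat \<lceil>2 * Y - b\<rceil>" arbitrary: a b c rule: less_induct)
  case less
  note v = less.prems(1-3)
  from v have bq: "1 \<le> q" "q \<le> b" "\<bar>a * q - b * p\<bar> = 1" by auto
  define h where "h = 1/2 * (q powr - \<alpha> * (2 * Y) powr - \<alpha>)"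
  show ?case
  proof (cases "Y \<le> b")
    case True
    \<comment> \<open>Density at least 1/2 and b \<le> 2Y: this tail carries at least the mass h,
      and by \<open>hit\<close> none of it lies in B.\<close>
    have "h \<le> c * (q powr - \<alpha> * b powr - \<alpha>)"
      unfolding h_def using v(2) bq less.prems(5) exponent_pos
      by (intro mult_mono mult_left_mono powr_mono2') auto
    then have "0 \<le> A * (mass (Tail a b p q) c UNIV - h)"
      unfolding tail_mass[OF v] using AR by (intro mult_nonneg_nonneg) auto
    moreover have "0 \<le> kappa * R * (b powr - (\<alpha>/2) * q powr - \<alpha>)"
      using AR kappa_pos by simp
    ultimately show ?thesis using hit[OF v True] unfolding h_def by linarith
  next
    case False
    define n where "n = b div q"
    define b' where "b' = b + n * q"
    note s = tail_step[OF v(1), folded n_def]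
    have b': "b < b'" "real_of_int b' \<le> 2 * Y" "b \<le> b'" "b' \<le> 2 * b" "3 * b \<le> 2 * b'"
    proof -
      have "1 * 1 \<le> n * q" using s bq by (intro mult_mono) auto
      then show "b < b'" "b \<le> b'" by (auto simp: b'_def)
      show "b' \<le> 2 * b" "3 * b \<le> 2 * b'" using s by (auto simp: b'_def)
      then show "real_of_int b' \<le> 2 * Y" using False by linarith
    qed
    have vT: "valid_node (Tail (a + n * p) b' p q)" using s by (simp add: b'_def)
    have T: "mass (Tail (a + n * p) b' p q) c' B \<le>
      A * (mass (Tail (a + n * p) b' p q) c' UNIV - h) +
      kappa * R * ((2/3) powr (\<alpha>/2) * (b powr - (\<alpha>/2) * q powr - \<alpha>))"
      if c': "1/2 \<le> c'" "c' \<le> 3" for c'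
    proof -
      have "mass (Tail (a + n * p) b' p q) c' B \<le>
         A * (mass (Tail (a + n * p) b' p q) c' UNIV - h) +
         kappa * R * (b' powr - (\<alpha>/2) * q powr - \<alpha>)"
        unfolding h_def
      proof (rule less.hyps[OF _ vT c'])
        have "2 * Y - b' \<le> 2 * Y - b - 1" using b' by linarith
        then show "nat \<lceil>2 * Y - b'\<rceil> < nat \<lceil>2 * Y - b\<rceil>" using b' False bq by linarith
      qed (use b' less.prems in auto)
      \<comment> \<open>Since b' is at least 3/2 times b, the error term gains the factor
        \<open>(2/3) powr (\<alpha>/2)\<close>.\<close>
      also have "b' powr - (\<alpha>/2) \<le> (3/2 * real_of_int b) powr - (\<alpha>/2)"
        using b' bq exponent_pos by (intro powr_mono2') auto
      also have "(3/2 * real_of_int b) powr - (\<alpha>/2) = (3/2) powr - (\<alpha>/2) * b powr - (\<alpha>/2)"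
        by (rule powr_mult)
      also have "(3/2 :: real) powr - (\<alpha>/2) = (2/3) powr (\<alpha>/2)"
        by (simp add: powr_minus powr_divide field_simps)
      finally show ?thesis using AR kappa_pos by (simp add: mult_left_mono mult_right_mono mult.assoc)
    qed
    from v show ?thesis
    proof (cases rule: tail_mass_split)
      case (1 c')
      note eq = 1(3)[folded n_def, folded b'_def]
      have "mass (block a b p q n) c' B \<le> (A + R * (2 * real_of_int b) powr (\<alpha>/2)) * mass (block a b p q n) c' UNIV"
      proof (rule block_mass_le[OF B, where ?q0.0 = q0 and Q = "2 * b"])
        fix a' b' p' q' :: int and c'' :: real
        assume *: "fresh a' b' p' q'" "1/2 \<le> c''" "c'' \<le> 3" "q0 \<le> q'" "q' \<le> 2 * b"
        then have "0 \<le> q'" by (simp add: fresh_def)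
        then have "(A + R * q' powr (\<alpha>/2)) * mass (Tail a' b' p' q') c'' UNIV \<le>
          (A + R * (2 * real_of_int b) powr (\<alpha>/2)) * mass (Tail a' b' p' q') c'' UNIV"
          using * AR exponent_pos
          by (intro mult_right_mono add_left_mono mult_left_mono powr_mono2 mass_nonneg) auto
        with H[OF *(1-4)] show "mass (Tail a' b' p' q') c'' B \<le>
          (A + R * (2 * real_of_int b) powr (\<alpha>/2)) * mass (Tail a' b' p' q') c'' UNIV" by linarith
      qed (use s bq less.prems 1 in auto)
      \<comment> \<open>The 6 is 2 * 3: fresh denominators are at most 2b, which costs
        \<open>2 powr (\<alpha>/2) \<le> 2\<close>, and the block has density at most 3.\<close>
      moreover have "R * (2 * real_of_int b) powr (\<alpha>/2) * mass (block a b p q n) c' UNIV \<le>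
          6 * R * (b powr - (\<alpha>/2) * q powr - \<alpha>)"
      proof -
        have "mass (block a b p q n) c' UNIV = c' * (node_hi (block a b p q n) - node_lo (block a b p q n)) powr \<alpha>"
          by (rule mass_UNIV[OF s(5) 1(1,2)])
        also have "\<dots> \<le> 3 * (1 / real_of_int (q * b)) powr \<alpha>"
          using 1(1,2) node.len_pos[OF s(5)] block_len_le[OF bq(1,3) s(1,2)] exponent_pos
          by (intro mult_mono powr_mono2) auto
        also have "(1 / real_of_int (q * b)) powr \<alpha> = q powr - \<alpha> * b powr - \<alpha>"
          using bq by (simp add: powr_minus powr_divide powr_mult field_simps)
        finally have m: "mass (block a b p q n) c' UNIV \<le> 3 * (q powr - \<alpha> * b powr - \<alpha>)" .
        have "(2 * real_of_int b) powr (\<alpha>/2) = 2 powr (\<alpha>/2) * b powr (\<alpha>/2)"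
          using bq by (simp add: powr_mult)
        also have "\<dots> \<le> 2 powr 1 * b powr (\<alpha>/2)"
          using exponent_le_1 by (intro mult_right_mono powr_mono) auto
        finally have "(2 * real_of_int b) powr (\<alpha>/2) \<le> 2 * b powr (\<alpha>/2)" by simp
        then have "R * (2 * real_of_int b) powr (\<alpha>/2) * mass (block a b p q n) c' UNIV \<le>
            R * (2 * b powr (\<alpha>/2)) * (3 * (q powr - \<alpha> * b powr - \<alpha>))"
          using AR m 1 by (intro mult_mono mult_left_mono mass_nonneg) auto
        also have "\<dots> = 6 * R * ((b powr (\<alpha>/2) * b powr - \<alpha>) * q powr - \<alpha>)" by simp
        also have "b powr (\<alpha>/2) * b powr - \<alpha> = b powr - (\<alpha>/2)"
          by (simp flip: powr_add add: field_simps)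
        finally show ?thesis .
      qed
      ultimately have L: "mass (block a b p q n) c' B \<le> A * mass (block a b p q n) c' UNIV +
          6 * R * (b powr - (\<alpha>/2) * q powr - \<alpha>)"
        by (simp add: distrib_right)
      have "6 * R * (b powr - (\<alpha>/2) * q powr - \<alpha>) +
          kappa * R * ((2/3) powr (\<alpha>/2) * (b powr - (\<alpha>/2) * q powr - \<alpha>)) =
          (6 + kappa * (2/3) powr (\<alpha>/2)) * (R * (b powr - (\<alpha>/2) * q powr - \<alpha>))"
        by (simp add: algebra_simps)
      then have "6 * R * (b powr - (\<alpha>/2) * q powr - \<alpha>) +
          kappa * R * ((2/3) powr (\<alpha>/2) * (b powr - (\<alpha>/2) * q powr - \<alpha>)) =
          kappa * R * (b powr - (\<alpha>/2) * q powr - \<alpha>)"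
        unfolding kappa_eq by simp
      then show ?thesis
        using L T[OF 1(1,2)] eq[OF B] eq[of UNIV] unfolding h_def[symmetric]
        by (simp add: distrib_left right_diff_distrib)
    next
      case (2 c')
      note eq = 2(3)[folded n_def, folded b'_def]
      \<comment> \<open>Here the block is dropped, so no new error arises.\<close>
      have "kappa * (2/3) powr (\<alpha>/2) \<le> kappa" using kappa_eq by linarith
      then have "kappa * (2/3) powr (\<alpha>/2) * (R * (b powr - (\<alpha>/2) * q powr - \<alpha>)) \<le>
          kappa * (R * (b powr - (\<alpha>/2) * q powr - \<alpha>))"
        using AR by (intro mult_right_mono) auto
      then show ?thesis
        using T[OF 2(1,2)] eq[OF B] eq[of UNIV] unfolding h_def[symmetric]
        by (simp add: mult_ac)
    qed
  qed
qed

text \<open>Fresh tails exhaust the tail up to the point p/q. After m steps towards p/q the part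
  still unaccounted for has mass at most \<open>3 * (b + real m) powr - \<alpha>\<close>, which
  tends to 0.\<close>

lemma tail_mass_zero:
  assumes B: "B \<in> sets borel"
    and H: "\<And>a b p q c. fresh a b p q \<Longrightarrow> 1/2 \<le> c \<Longrightarrow> c \<le> 3 \<Longrightarrow> q0 \<le> q \<Longrightarrow>
      mass (Tail a b p q) c B = 0"
    and v: "valid_node (Tail a b p q)" "1/2 \<le> c" "c \<le> 3" "q0 \<le> b"
  shows "mass (Tail a b p q) c B = 0"
proof -
  have bound: "mass (Tail a b p q) c B \<le> 3 * (b + real m) powr - \<alpha>"
    if "valid_node (Tail a b p q)" "1/2 \<le> c" "c \<le> 3" "q0 \<le> b" for a b c m
    using that
  proof (induction m arbitrary: a b c)
    case 0
    then have bq: "1 \<le> q" "q \<le> b" by auto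
    have "mass (Tail a b p q) c B \<le> mass (Tail a b p q) c UNIV"
      using mass_mono[OF 0(1-3), of B UNIV] by simp
    also have "\<dots> \<le> 3 * (1 * b powr - \<alpha>)"
      unfolding tail_mass[OF 0(1-3)] using 0 bq exponent_pos
      by (intro mult_mono mult_right_mono) (auto simp: powr_minus inverse_le_1_iff intro!: ge_one_powr_ge_zero)
    finally show ?case by simp
  next
    case (Suc m)
    define n where "n = b div q"
    define b' where "b' = b + n * q"
    note s = tail_step[OF Suc.prems(1), folded n_def]
    from Suc.prems have bq: "1 \<le> q" "q \<le> b" "\<bar>a * q - b * p\<bar> = 1" by auto
    have "1 * 1 \<le> n * q" using s bq by (intro mult_mono) auto
    then have b': "b + 1 \<le> b'" by (auto simp: b'_def)
    have vT: "valid_node (Tail (a + n * p) b' p q)" using s by (simp add: b'_def)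
    have T: "mass (Tail (a + n * p) b' p q) c' B \<le> 3 * (b + real (Suc m)) powr - \<alpha>"
      if "1/2 \<le> c'" "c' \<le> 3" for c'
    proof -
      have "mass (Tail (a + n * p) b' p q) c' B \<le> 3 * (b' + real m) powr - \<alpha>"
        by (rule Suc.IH[OF vT that]) (use b' Suc.prems in auto)
      also have "\<dots> \<le> 3 * (b + real (Suc m)) powr - \<alpha>"
        using b' bq exponent_pos by (intro mult_left_mono powr_mono2') auto
      finally show ?thesis .
    qed
    from Suc.prems(1-3) show ?case
    proof (cases rule: tail_mass_split)
      case (1 c')
      have "mass (block a b p q n) c' B \<le> 0 * mass (block a b p q n) c' UNIV"
        by (rule block_mass_le[OF B, where ?q0.0 = q0 and Q = "2 * b"])
          (use s bq Suc.prems 1 H in auto)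
      then show ?thesis
        using T[OF 1(1,2)] 1(3)[OF B] unfolding n_def[symmetric] b'_def by simp
    next
      case (2 c')
      then show ?thesis
        using T[OF 2(1,2)] 2(3)[OF B] unfolding n_def[symmetric] b'_def by simp
    qed
  qed
  have "filterlim (\<lambda>m. of_int b + real m) at_top sequentially"
    by (intro filterlim_tendsto_add_at_top[OF tendsto_const] filterlim_real_sequentially)
  then have "(\<lambda>m. 3 * (b + real m) powr - \<alpha>) \<longlonglongrightarrow> 3 * 0"
    using exponent_pos by (intro tendsto_mult tendsto_const tendsto_neg_powr) auto
  then have "mass (Tail a b p q) c B \<le> 3 * 0"
    by (rule LIMSEQ_le_const) (use bound[OF v] in auto)
  moreover have "0 \<le> mass (Tail a b p q) c B" using v by (intro mass_nonneg) auto
  ultimately show ?thesis by simp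
qed

end

text \<open>By \<open>1 - t \<le> exp (- t)\<close> the product is at most the exponential of minus
  a partial sum, and these sums are unbounded from any k on.\<close>

lemma prod_small_if_not_summable:
  fixes d :: "nat \<Rightarrow> real"
  assumes d: "\<And>j. 0 \<le> d j" "\<And>j. d j \<le> 1" and "\<not> summable d" "\<epsilon> > 0"
  shows "\<exists>n. (\<Prod>j<n. 1 - d (k + j)) < \<epsilon>"
proof -
  have "\<not> summable (\<lambda>j. d (k + j))"
    using assms(3) summable_iff_shift[of d k] by (simp add: add.commute)
  then have "\<exists>n. \<not> (\<Sum>j<n. d (k + j)) \<le> - ln \<epsilon>"
    using summableI_nonneg_bounded[of "\<lambda>j. d (k + j)" "- ln \<epsilon>"] d(1) by metis
  then obtain n where n: "- ln \<epsilon> < (\<Sum>j<n. d (k + j))" by (auto simp: not_le)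
  have "(\<Prod>j<n. 1 - d (k + j)) \<le> (\<Prod>j<n. exp (- d (k + j)))"
    using exp_ge_add_one_self[of "- d _"] d by (intro prod_mono) auto
  also have "\<dots> = exp (- (\<Sum>j<n. d (k + j)))"
    by (simp add: exp_sum sum_negf[symmetric])
  also have "\<dots> < exp (ln \<epsilon>)" using n by simp
  finally show ?thesis using assms(4) by auto
qed

text \<open>A Borel set increasing with m. The irrationals that are not \<psi>-approximable lie in
  the union over m, so it suffices that each of these sets is null.\<close>

definition far_set :: "(nat \<Rightarrow> real) \<Rightarrow> nat \<Rightarrow> real set" where
  "far_set \<psi> m = {x. \<forall>(p::int) (q::nat). 1 \<le> q \<longrightarrow> m \<le> q \<longrightarrow> coprime p (int q) \<longrightarrow>
     \<psi> q < \<bar>x - of_int p / of_nat q\<bar>}"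

lemma far_set_borel: "far_set \<psi> m \<in> sets borel"
proof -
  have "far_set \<psi> m = {x \<in> space borel. \<forall>(p::int) (q::nat). 1 \<le> q \<longrightarrow> m \<le> q \<longrightarrow> coprime p (int q) \<longrightarrow>
     \<psi> q < \<bar>x - of_int p / of_nat q\<bar>}" by (simp add: far_set_def)
  also have "\<dots> \<in> sets borel" by measurable
  finally show ?thesis .
qed

lemma psi_approximable_or_far:
  assumes "x \<notin> \<rat>" "\<not> psi_approximable \<psi> x"
  shows "\<exists>m. x \<in> far_set \<psi> m"
proof -
  let ?S = "{(p :: int, q :: nat). q \<ge> 1 \<and> coprime p (int q) \<and> \<bar>x - of_int p / of_nat q\<bar> \<le> \<psi> q}"
  have "finite ?S" using assms by (simp add: psi_approximable_def)
  then have "finite (snd ` ?S)" by (rule finite_imageI)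
  then obtain m where m: "\<forall>q\<in>snd ` ?S. q < m"
    unfolding finite_nat_set_iff_bounded ..
  have "x \<in> far_set \<psi> m"
    unfolding far_set_def
  proof (intro CollectI allI impI, rule ccontr)
    fix p :: int and q :: nat
    assume *: "1 \<le> q" "m \<le> q" "coprime p (int q)" "\<not> \<psi> q < \<bar>x - of_int p / of_nat q\<bar>"
    then have "(p, q) \<in> ?S" by auto
    then have "snd (p, q) \<in> snd ` ?S" by (rule imageI)
    from bspec[OF m this] have "q < m" by simp
    then show False using * by simp
  qed
  then show ?thesis ..
qed

section \<open>Iteration over the digits: the conditional Borel--Cantelli argument\<close>

context cf_measure
begin

text \<open>The tail has length 1 / (q b) \<le> f / q^2 \<le> \<psi>(q), so p/q itself is a good
  approximation to all of its points. The determinant condition puts p/q in lowest terms.\<close>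

lemma tail_far_mass:
  fixes \<psi> :: "nat \<Rightarrow> real"
  assumes v: "valid_node (Tail a b p q)" "1/2 \<le> c" "c \<le> 3" and m: "int m \<le> q"
    and f: "0 < f" "f \<le> q ^ 2 * \<psi> (nat q)" "q / f \<le> b"
  shows "mass (Tail a b p q) c (far_set \<psi> m) = 0"
proof (rule mass_disjoint[OF v far_set_borel])
  from v have bq: "1 \<le> q" "q \<le> b" "\<bar>a * q - b * p\<bar> = 1" by auto
  have cop: "coprime p q"
  proof (rule coprimeI)
    fix d assume "d dvd p" "d dvd q"
    then have "d dvd a * q - b * p" by simp
    then have "d dvd \<bar>a * q - b * p\<bar>" by simp
    then show "is_unit d" unfolding bq(3) .
  qed
  have "\<bar>x - p / q\<bar> \<le> \<psi> (nat q)" if "x \<in> {node_lo (Tail a b p q)..node_hi (Tail a b p q)}" for x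
  proof -
    have "\<bar>x - p / q\<bar> \<le> node_hi (Tail a b p q) - node_lo (Tail a b p q)"
      using that by (auto simp: node_lo_def node_hi_def)
    also have "\<dots> = 1 / (real_of_int q * b)" unfolding tail_len[OF v(1)] by simp
    also have "\<dots> \<le> 1 / (q * (q / f))"
      using f bq by (intro divide_left_mono mult_left_mono mult_pos_pos divide_pos_pos) auto
    also have "\<dots> = f / q ^ 2" by (simp add: power2_eq_square)
    also have "\<dots> \<le> \<psi> (nat q)" using f(2) bq by (simp add: divide_le_eq mult.commute)
    finally show ?thesis .
  qed
  then have near: "\<not> \<psi> (nat q) < \<bar>x - p / real (nat q)\<bar>"
    if "x \<in> {node_lo (Tail a b p q)..node_hi (Tail a b p q)}" for x
    using that bq(1) by (simp add: not_less)
  have "1 \<le> nat q" "m \<le> nat q" "coprime p (int (nat q))" using bq(1) m cop by auto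
  then have "\<psi> (nat q) < \<bar>x - p / real (nat q)\<bar>" if "x \<in> far_set \<psi> m" for x
    using that unfolding far_set_def mem_Collect_eq by metis
  with near show "{node_lo (Tail a b p q)..node_hi (Tail a b p q)} \<inter> far_set \<psi> m = {}"
    by blast
qed

text \<open>One digit of the argument: \<open>tail_mass_le\<close> with Y = q / f, where f will be
  min 1 (q^2 \<psi>(q)). Freshness gives q < b \<le> 2q, so the total mass is comparable to q to the
  power -2\<alpha>.\<close>

lemma fresh_mass_step:
  assumes B: "B \<in> sets borel" and AR: "0 \<le> A" "0 \<le> R"
    and H: "\<And>a b p q c. fresh a b p q \<Longrightarrow> 1/2 \<le> c \<Longrightarrow> c \<le> 3 \<Longrightarrow> q0 \<le> q \<Longrightarrow>
      mass (Tail a b p q) c B \<le> (A + R * q powr (\<alpha>/2)) * mass (Tail a b p q) c UNIV"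
    and f: "0 < f" "f \<le> 1"
    and hit: "\<And>a b c. valid_node (Tail a b p q) \<Longrightarrow> 1/2 \<le> c \<Longrightarrow> c \<le> 3 \<Longrightarrow> q / f \<le> b \<Longrightarrow>
      mass (Tail a b p q) c B = 0"
    and fr: "fresh a b p q" and c: "1/2 \<le> c" "c \<le> 3" and q0: "q0 \<le> q"
  shows "mass (Tail a b p q) c B \<le>
    (A * (1 - f powr \<alpha> / 12) + 4 * kappa * R * q powr (\<alpha>/2)) * mass (Tail a b p q) c UNIV"
proof -
  from fr have v: "valid_node (Tail a b p q)" and bq: "1 \<le> q" "q < b" "b \<le> 2 * q"
    by (auto simp: fresh_def)
  define U where "U = real_of_int q powr - \<alpha>"
  define M where "M = mass (Tail a b p q) c UNIV"
  have U: "U > 0" using bq by (simp add: U_def)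
  have half: "1/2 \<le> 2 powr - \<alpha>"
    using exponent_le_1 powr_mono[of "-1" "- \<alpha>" 2] by (simp add: powr_minus)
  have M: "M = c * (U * b powr - \<alpha>)" unfolding M_def U_def by (rule tail_mass[OF v c])
  have "b powr - \<alpha> \<le> U"
    unfolding U_def using bq exponent_pos by (intro powr_mono2') auto
  then have M_le: "M \<le> 3 * (U * U)"
    unfolding M using c U by (intro mult_mono mult_left_mono) auto
  have "1/2 * U \<le> 2 powr - \<alpha> * U" using half U by (intro mult_right_mono) auto
  also have "\<dots> = (2 * real_of_int q) powr - \<alpha>" by (simp add: U_def powr_mult)
  also have "\<dots> \<le> b powr - \<alpha>"
    using bq exponent_pos by (intro powr_mono2') auto
  finally have bU: "1/2 * U \<le> b powr - \<alpha>" .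
  have "1/2 * (U * (1/2 * U)) \<le> M"
    unfolding M using c U bU by (intro mult_mono mult_left_mono) auto
  then have M_ge: "U * U \<le> 4 * M" by simp
  have "mass (Tail a b p q) c B \<le>
      A * (M - 1/2 * (q powr - \<alpha> * (2 * (q / f)) powr - \<alpha>)) +
      kappa * R * (b powr - (\<alpha>/2) * q powr - \<alpha>)"
    unfolding M_def
  proof (rule tail_mass_le[OF B AR H hit v c])
    have "2 * real_of_int q / 1 \<le> 2 * real_of_int q / f" using f bq by (intro divide_left_mono) auto
    moreover have "real_of_int b \<le> 2 * real_of_int q" using bq by linarith
    ultimately show "real_of_int b \<le> 2 * (q / f)" by simp
  qed (use q0 bq in auto)
  also have "A * (M - 1/2 * (q powr - \<alpha> * (2 * (q / f)) powr - \<alpha>)) \<le> A * (M - f powr \<alpha> / 12 * M)"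
  proof (intro mult_left_mono diff_left_mono AR)
    \<comment> \<open>The 12 is 3 * 2 * 2: from \<open>M \<le> 3 * (U * U)\<close>, from the density
      1/2 in the reserved mass, and from \<open>2 powr - \<alpha> \<ge> 1/2\<close>.\<close>
    have "f powr \<alpha> / 12 * M \<le> f powr \<alpha> / 12 * (3 * (U * U))"
      using M_le by (intro mult_left_mono) auto
    also have "\<dots> = 1/2 * (U * (1/2 * (U * f powr \<alpha>)))" by simp
    also have "\<dots> \<le> 1/2 * (U * (2 powr - \<alpha> * (U * f powr \<alpha>)))"
      using half U by (intro mult_left_mono mult_right_mono) auto
    also have "2 powr - \<alpha> * (U * f powr \<alpha>) = (2 * (q / f)) powr - \<alpha>"
      unfolding U_def powr_mult powr_divide by (simp add: powr_minus divide_inverse)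
    finally show "f powr \<alpha> / 12 * M \<le> 1/2 * (q powr - \<alpha> * (2 * (q / f)) powr - \<alpha>)"
      by (simp add: U_def)
  qed
  also have "kappa * R * (b powr - (\<alpha>/2) * q powr - \<alpha>) \<le> kappa * R * (q powr (\<alpha>/2) * (4 * M))"
  proof (intro mult_left_mono)
    have "b powr - (\<alpha>/2) * q powr - \<alpha> \<le> q powr - (\<alpha>/2) * U"
      unfolding U_def using bq exponent_pos by (intro mult_right_mono powr_mono2') auto
    also have "real_of_int q powr - (\<alpha>/2) = q powr (\<alpha>/2) * U"
      unfolding U_def by (simp flip: powr_add)
    also have "q powr (\<alpha>/2) * U * U \<le> q powr (\<alpha>/2) * (4 * M)"
      unfolding mult.assoc using M_ge by (intro mult_left_mono) auto
    finally show "b powr - (\<alpha>/2) * q powr - \<alpha> \<le> q powr (\<alpha>/2) * (4 * M)" .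
  qed (use AR kappa_pos in auto)
  finally show ?thesis unfolding M_def[symmetric] by (simp add: algebra_simps)
qed

text \<open>The bound is iterated over the digits with the threshold \<open>2 ^ (k * l)\<close> for the \<open>k\<close>-th denominator: below
  the threshold the hitting probability is at least \<open>g k\<close> by monotonicity, and above it the error term is already
  at least 1. The step \<open>l\<close> is chosen such that the error terms decrease geometrically.\<close>

lemma fresh_far_mass_zero:
  fixes \<psi> :: "nat \<Rightarrow> real"
  assumes pos: "\<forall>q\<ge>1. \<psi> q > 0" and anti: "antimono_on {1..} (\<lambda>q. (real q)\<^sup>2 * \<psi> q)"
    and div: "\<not> summable (\<lambda>n. real (Suc n) powr (2 * \<alpha> - 1) * \<psi> (Suc n) powr \<alpha>)"
    and fr: "fresh a b p q" and c: "1/2 \<le> c" "c \<le> 3" and m: "int m \<le> q"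
  shows "mass (Tail a b p q) c (far_set \<psi> m) = 0"
proof -
  define F where "F n = min 1 ((real n)\<^sup>2 * \<psi> n)" for n :: nat
  have Fpos: "0 < F n" if "1 \<le> n" for n using pos that by (simp add: F_def)
  have Fanti: "F n' \<le> F n" if "1 \<le> n" "n \<le> n'" for n n'
    unfolding F_def using monotone_onD[OF anti, of n n'] that by (intro min.mono) auto
  define y where "y = 2 powr - (\<alpha>/2)"
  have "2 powr - (\<alpha>/2) < 2 powr (0::real)"
    using exponent_pos by (intro powr_less_mono) auto
  then have y: "0 < y" "y < 1" by (auto simp: y_def)
  \<comment> \<open>This makes \<open>8 * kappa * x \<le> 1\<close> for x = y^l, so the factor
    \<open>4 * kappa\<close> lost per digit is absorbed when k becomes \<open>Suc k\<close>.\<close>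
  obtain l0 where l0: "y ^ l0 < 1 / (8 * kappa)"
    using real_arch_pow_inv[of "1 / (8 * kappa)" y] kappa_pos y by auto
  define l where "l = max 1 l0"
  have l: "1 \<le> l" by (simp add: l_def)
  define x where "x = y ^ l"
  have "x \<le> y ^ l0" unfolding x_def l_def using y by (intro power_decreasing) auto
  then have "4 * kappa * 2 * x \<le> 4 * kappa * 2 * (1 / (8 * kappa))"
    using l0 kappa_pos by (intro mult_left_mono) auto
  then have Kx: "4 * kappa * 2 * x \<le> 1" using kappa_pos by simp
  have x: "0 < x" "x < 1" unfolding x_def using y l by (auto simp: power_less_one_iff)
  define g where "g k = F (2 ^ (k * l)) powr \<alpha> / 12" for k
  have F1: "F (2 ^ (k * l)) powr \<alpha> \<le> 1" for k
    using Fpos[of "2 ^ (k * l)"] exponent_pos powr_mono2[of \<alpha> "F (2 ^ (k * l))" 1] by (simp add: F_def)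
  have g: "0 \<le> g k" "g k \<le> 1" for k using F1[of k] by (auto simp: g_def)
  have "\<not> summable (\<lambda>k. F (2 ^ (k * l)) powr \<alpha>)"
    using not_summable_truncated_subsequence[OF pos anti exponent_pos div l] by (simp add: F_def)
  moreover have "(\<lambda>k. F (2 ^ (k * l)) powr \<alpha>) = (\<lambda>k. 12 * g k)" by (simp add: g_def)
  ultimately have gdiv: "\<not> summable g" using summable_mult[of g 12] by metis
  \<comment> \<open>Here n is the number of digits still to be used and k the index of the current
    threshold; a digit step replaces k by \<open>Suc k\<close>.\<close>
  have main: "mass (Tail a b p q) c (far_set \<psi> m) \<le>
      ((\<Prod>j<n. 1 - g (k + j)) + 2 * x ^ k * q powr (\<alpha>/2)) * mass (Tail a b p q) c UNIV"
    if "fresh a b p q" "1/2 \<le> c" "c \<le> 3" "int m \<le> q" for a b p q c n k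
    using that
  proof (induction n arbitrary: a b p q c k)
    case (0 a b p q c k)
    have v: "valid_node (Tail a b p q)" using 0 by (simp add: fresh_def)
    have "mass (Tail a b p q) c (far_set \<psi> m) \<le> 1 * mass (Tail a b p q) c UNIV"
      using mass_mono[OF v 0(2,3), of _ UNIV] by simp
    also have "\<dots> \<le> ((\<Prod>j<0. 1 - g (k + j)) + 2 * x ^ k * q powr (\<alpha>/2)) * mass (Tail a b p q) c UNIV"
      using x 0 by (intro mult_right_mono mass_nonneg) auto
    finally show ?case .
  next
    case (Suc n a b p q c k)
    have v: "valid_node (Tail a b p q)" using Suc.prems by (simp add: fresh_def)
    have q: "1 \<le> q" using v by simp
    have prod_nonneg: "0 \<le> (\<Prod>j<n. 1 - g (k + j))" for n k using g by (intro prod_nonneg) auto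
    show ?case
    proof (cases "q \<le> 2 ^ (k * l)")
      case False
      \<comment> \<open>As x is 2 to the power -l \<alpha>/2, the quantity
        \<open>x ^ k * q powr (\<alpha>/2)\<close> reaches 1 exactly at the threshold; beyond it the
        total mass is a sufficient bound.\<close>
      have xk: "x ^ k * (2 ^ (k * l)) powr (\<alpha>/2) = 1"
      proof -
        have "x ^ k = y ^ (k * l)" unfolding x_def by (simp add: mult.commute flip: power_mult)
        also have "\<dots> = 2 powr (- (\<alpha>/2) * real (k * l))"
          unfolding y_def by (simp add: powr_powr flip: powr_realpow)
        finally have "x ^ k = 2 powr (- (\<alpha>/2) * real (k * l))" .
        moreover have "(2 ^ (k * l)) powr (\<alpha>/2) = 2 powr (real (k * l) * (\<alpha>/2))"
          by (simp add: powr_powr flip: powr_realpow)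
        ultimately show ?thesis by (simp flip: powr_add)
      qed
      have "(2::real) ^ (k * l) \<le> q" using False
        by (metis linear of_int_le_iff of_int_numeral of_int_power)
      then have "x ^ k * (2 ^ (k * l)) powr (\<alpha>/2) \<le> x ^ k * q powr (\<alpha>/2)"
        using x exponent_pos by (intro mult_left_mono powr_mono2) auto
      then have "1 \<le> x ^ k * q powr (\<alpha>/2)" unfolding xk .
      then have "1 \<le> (\<Prod>j<Suc n. 1 - g (k + j)) + 2 * x ^ k * q powr (\<alpha>/2)"
        using prod_nonneg[where k=k and n="Suc n"] by linarith
      then have "1 * mass (Tail a b p q) c UNIV \<le>
        ((\<Prod>j<Suc n. 1 - g (k + j)) + 2 * x ^ k * q powr (\<alpha>/2)) * mass (Tail a b p q) c UNIV"
        using Suc.prems by (intro mult_right_mono mass_nonneg) auto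
      then show ?thesis using mass_mono[OF v Suc.prems(2,3), of "far_set \<psi> m" UNIV] by simp
    next
      case True
      define f where "f = F (nat q)"
      have f: "0 < f" "f \<le> 1" "f \<le> (real_of_int q)\<^sup>2 * \<psi> (nat q)"
        using Fpos[of "nat q"] q by (auto simp: f_def F_def)
      have "nat q \<le> 2 ^ (k * l)" using True by simp
      then have "F (2 ^ (k * l)) \<le> f" unfolding f_def using q by (intro Fanti) auto
      then have gf: "g k \<le> f powr \<alpha> / 12"
        unfolding g_def using Fpos[of "2 ^ (k * l)"] exponent_pos
        by (intro divide_right_mono powr_mono2) auto
      define A where "A = (\<Prod>j<n. 1 - g (Suc k + j))"
      have "mass (Tail a b p q) c (far_set \<psi> m) \<le>
        (A * (1 - f powr \<alpha> / 12) + 4 * kappa * (2 * x ^ Suc k) * q powr (\<alpha>/2)) *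
          mass (Tail a b p q) c UNIV"
      proof (rule fresh_mass_step[OF far_set_borel _ _ _ f(1,2) _ Suc.prems])
        show "0 \<le> A" unfolding A_def by (rule prod_nonneg)
        show "0 \<le> 2 * x ^ Suc k" using x by simp
        show "mass (Tail a b p q) c (far_set \<psi> m) \<le>
            (A + 2 * x ^ Suc k * q powr (\<alpha>/2)) * mass (Tail a b p q) c UNIV"
          if "fresh a b p q" "1/2 \<le> c" "c \<le> 3" "int m \<le> q" for a b p q c
          unfolding A_def by (rule Suc.IH[OF that])
        show "mass (Tail a b p q) c (far_set \<psi> m) = 0"
          if "valid_node (Tail a b p q)" "1/2 \<le> c" "c \<le> 3" "q / f \<le> b" for a b c
          using that(1-3) Suc.prems(4) f(1,3) that(4) by (rule tail_far_mass[where \<psi> = \<psi> and m = m and f = f])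
      qed
      also have "\<dots> \<le> ((\<Prod>j<Suc n. 1 - g (k + j)) + 2 * x ^ k * q powr (\<alpha>/2)) *
          mass (Tail a b p q) c UNIV"
      proof (intro mult_right_mono add_mono mass_nonneg)
        have "A * (1 - f powr \<alpha> / 12) \<le> A * (1 - g k)"
          using gf prod_nonneg[where k="Suc k" and n=n] by (intro mult_left_mono) (auto simp: A_def)
        also have "\<dots> = (\<Prod>j<Suc n. 1 - g (k + j))"
          unfolding A_def by (simp add: prod.lessThan_Suc_shift del: prod.lessThan_Suc)
        finally show "A * (1 - f powr \<alpha> / 12) \<le> (\<Prod>j<Suc n. 1 - g (k + j))" .
        have "4 * kappa * (2 * x ^ Suc k) = (4 * kappa * 2 * x) * x ^ k" by simp
        also have "\<dots> \<le> 1 * x ^ k" using Kx x by (intro mult_right_mono) auto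
        also have "\<dots> \<le> 2 * x ^ k" using x by simp
        finally show "4 * kappa * (2 * x ^ Suc k) \<le> 2 * x ^ k" .
      qed (use Suc.prems in auto)
      finally show ?thesis .
    qed
  qed
  define M where "M = mass (Tail a b p q) c UNIV"
  have M: "0 \<le> M" unfolding M_def using c by (intro mass_nonneg) auto
  \<comment> \<open>For fixed k, many digits make the product arbitrarily small by divergence;
    afterwards k tends to infinity and removes the error term.\<close>
  have k_bound: "mass (Tail a b p q) c (far_set \<psi> m) \<le> 2 * x ^ k * q powr (\<alpha>/2) * M" for k
  proof (rule field_le_epsilon)
    fix e :: real assume e: "e > 0"
    obtain n where n: "(\<Prod>j<n. 1 - g (k + j)) < e / (M + 1)"
      using prod_small_if_not_summable[OF g gdiv, of "e / (M + 1)" k] e M by auto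
    have "mass (Tail a b p q) c (far_set \<psi> m) \<le>
        ((\<Prod>j<n. 1 - g (k + j)) + 2 * x ^ k * q powr (\<alpha>/2)) * M"
      unfolding M_def by (rule main[OF fr c m])
    also have "\<dots> \<le> (e / (M + 1) + 2 * x ^ k * q powr (\<alpha>/2)) * M"
      using n M by (intro mult_right_mono) auto
    also have "\<dots> = e * (M / (M + 1)) + 2 * x ^ k * q powr (\<alpha>/2) * M" by (simp add: distrib_right)
    also have "e * (M / (M + 1)) \<le> e * 1" using M e by (intro mult_left_mono) auto
    finally show "mass (Tail a b p q) c (far_set \<psi> m) \<le> 2 * x ^ k * q powr (\<alpha>/2) * M + e" by simp
  qed
  have "(\<lambda>k. 2 * x ^ k * q powr (\<alpha>/2) * M) \<longlonglongrightarrow> 2 * 0 * q powr (\<alpha>/2) * M"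
    using x by (intro tendsto_intros LIMSEQ_realpow_zero) auto
  then have "mass (Tail a b p q) c (far_set \<psi> m) \<le> 2 * 0 * q powr (\<alpha>/2) * M"
    by (rule LIMSEQ_le_const) (use k_bound in auto)
  moreover have "0 \<le> mass (Tail a b p q) c (far_set \<psi> m)" using c by (intro mass_nonneg) auto
  ultimately show ?thesis by simp
qed

text \<open>Denominators below \<open>m\<close> are handled by passing to the next fresh tails, whose denominators are larger.\<close>

lemma tail_far_mass_zero:
  fixes \<psi> :: "nat \<Rightarrow> real"
  assumes pos: "\<forall>q\<ge>1. \<psi> q > 0" and anti: "antimono_on {1..} (\<lambda>q. (real q)\<^sup>2 * \<psi> q)"
    and div: "\<not> summable (\<lambda>n. real (Suc n) powr (2 * \<alpha> - 1) * \<psi> (Suc n) powr \<alpha>)"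
    and v: "valid_node (Tail a b p q)" and c: "1/2 \<le> c" "c \<le> 3"
  shows "mass (Tail a b p q) c (far_set \<psi> m) = 0"
proof -
  have "mass (Tail a b p q) c (far_set \<psi> m) = 0"
    if "fresh a b p q" "1/2 \<le> c" "c \<le> 3" "int m \<le> q + int k" for a b p q c k
    using that
  proof (induction k arbitrary: a b p q c)
    case 0
    then show ?case using fresh_far_mass_zero[OF pos anti div] by simp
  next
    case (Suc k)
    then have f: "valid_node (Tail a b p q)" "q < b" by (auto simp: fresh_def)
    show ?case
    proof (rule tail_mass_zero[OF far_set_borel _ f(1) Suc.prems(2,3)])
      \<comment> \<open>Fresh tails inside this tail have denominators at least b > q, so the
        deficit m - q drops by at least 1.\<close>
      show "q + 1 \<le> b" using f by simp
      show "mass (Tail a' b' p' q') c' (far_set \<psi> m) = 0"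
        if "fresh a' b' p' q'" "1/2 \<le> c'" "c' \<le> 3" "q + 1 \<le> q'" for a' b' p' q' c'
        using Suc.IH[OF that(1-3)] that(4) Suc.prems(4) by simp
    qed
  qed
  from this[where k=m] show ?thesis
    by (intro tail_mass_zero[OF far_set_borel _ v c, where ?q0.0 = 1]) (use v in auto)
qed

theorem AE_psi_approximable:
  fixes \<psi> :: "nat \<Rightarrow> real"
  assumes pos: "\<forall>q\<ge>1. \<psi> q > 0" and anti: "antimono_on {1..} (\<lambda>q. (real q)\<^sup>2 * \<psi> q)"
    and div: "\<not> summable (\<lambda>n. real (Suc n) powr (2 * \<alpha> - 1) * \<psi> (Suc n) powr \<alpha>)"
    and v: "valid_node (Tail a b p q)" and c: "1/2 \<le> c" "c \<le> 3"
    and irr: "AE x in state.law (Tail a b p q, c). x \<notin> \<rat>"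
  shows "AE x in state.law (Tail a b p q, c). psi_approximable \<psi> x"
proof -
  let ?\<mu> = "state.law (Tail a b p q, c)"
  interpret finite_measure ?\<mu> using v c by (intro law_finite)
  have "AE x in ?\<mu>. x \<notin> far_set \<psi> m" for m
  proof -
    have "measure ?\<mu> (far_set \<psi> m) = 0"
      using tail_far_mass_zero[OF pos anti div v c, of m] c node.len_pos[OF v] by (simp add: mass_def)
    then have "far_set \<psi> m \<in> null_sets ?\<mu>"
      by (simp add: null_sets_def emeasure_eq_measure state.sets_law far_set_borel)
    then show ?thesis by (rule AE_not_in)
  qed
  then have "AE x in ?\<mu>. \<forall>m. x \<notin> far_set \<psi> m" by (simp add: AE_all_countable)
  with irr show ?thesis by eventually_elim (use psi_approximable_or_far in blast)
qed

end

theorem corollary1p5: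
  fixes \<alpha> :: real
  assumes "0 < \<alpha>" and "\<alpha> \<le> 1"
  shows "\<exists>\<mu> :: real measure.
    ahlfors_regular \<alpha> \<mu> \<and> absolutely_decaying \<alpha> \<mu> \<and>
    (\<forall>\<psi> :: nat \<Rightarrow> real.
       (\<forall>q\<ge>1. \<psi> q > 0) \<longrightarrow>
       antimono_on {1..} (\<lambda>q. (real q)\<^sup>2 * \<psi> q) \<longrightarrow>
       (\<not> summable (\<lambda>n. real (Suc n) powr (2 * \<alpha> - 1) * \<psi> (Suc n) powr \<alpha>)
          \<longrightarrow> (AE x in \<mu>. psi_approximable \<psi> x)) \<and>
       (summable (\<lambda>n. real (Suc n) powr (2 * \<alpha> - 1) * \<psi> (Suc n) powr \<alpha>)
          \<longrightarrow> (AE x in \<mu>. \<not> psi_approximable \<psi> x)))"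
proof -
  interpret cf_measure \<alpha> using assms by unfold_locales
  \<comment> \<open>The root is [0, 1]: formal convergents 1/0 and 0/1 with next digit at least
    1.\<close>
  have v: "valid_node (Tail 1 1 0 1)" by simp
  have hull: "node_lo (Tail 1 1 0 1) = 0" "node_hi (Tail 1 1 0 1) = 1"
    by (auto simp: node_lo_def node_hi_def)
  define \<mu> where "\<mu> = state.law (Tail 1 1 0 1, 1)"
  have fin: "finite_measure \<mu>" unfolding \<mu>_def by (rule law_finite[OF v]) auto
  interpret finite_measure \<mu> by (rule fin)
  have reg: "ahlfors_regular \<alpha> \<mu>"
    unfolding \<mu>_def by (rule ahlfors_regular_law[OF v]) (auto simp: hull)
  then have dec: "absolutely_decaying \<alpha> \<mu>"
    using assms(1) by (rule ahlfors_regular_imp_absolutely_decaying)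
  have irr: "AE x in \<mu>. x \<notin> \<rat>" by (rule AE_irrational[OF dec fin assms(1)])
  have "mass (Tail 1 1 0 1) 1 (- {0..1}) = 0"
    by (rule mass_disjoint[OF v]) (auto simp: hull)
  then have "- {0..1} \<in> null_sets \<mu>"
    by (simp add: mass_def hull null_sets_def emeasure_eq_measure \<mu>_def[symmetric])
      (simp add: \<mu>_def state.sets_law)
  then have supp: "AE x in \<mu>. x \<in> {0..1}" by (rule AE_I') auto
  show ?thesis
  proof (intro exI[of _ \<mu>] conjI reg dec allI impI)
    fix \<psi> :: "nat \<Rightarrow> real"
    assume pos: "\<forall>q\<ge>1. \<psi> q > 0" and anti: "antimono_on {1..} (\<lambda>q. (real q)\<^sup>2 * \<psi> q)"
    show "AE x in \<mu>. psi_approximable \<psi> x"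
      if "\<not> summable (\<lambda>n. real (Suc n) powr (2 * \<alpha> - 1) * \<psi> (Suc n) powr \<alpha>)"
      unfolding \<mu>_def
      by (rule AE_psi_approximable[OF pos anti that v]) (use irr[unfolded \<mu>_def] in auto)
    show "AE x in \<mu>. \<not> psi_approximable \<psi> x"
      if "summable (\<lambda>n. real (Suc n) powr (2 * \<alpha> - 1) * \<psi> (Suc n) powr \<alpha>)"
      by (rule AE_not_psi_approximable[OF dec fin supp assms(1) pos anti that])
  qed
qed

end
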